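(* Let $r=(2a+1)2^{4b+c}$ for some nonnegative integers $a,b,c$ with $c\leq3$, let $\rho_{\mathbb{R}}(r)=8b+2^c$, and let $n=\rho_{\mathbb{R}}(r)+2$. A totally symmetric $\mathrm{EITFF}_{\mathbb{R}}(2r,r,n)$ exists if $c\in\{0,1\}$, and does not exist if $c=3$.
   Context: EITFFs. Let $(\mathcal{U}_i)_{i=1}^n$, $n\geq2$, be $r$-dimensional subspaces of a $d$-dimensional real Hilbert space $\mathcal{E}$, with orthogonal projections $\Pi_i$. The sequence is an $\mathrm{EITFF}_{\mathbb{R}}(d,r,n)$ (equi-isoclinic tight fusion frame) if it is equi-isoclinic, meaning there is $\sigma\geq0$ with $\Pi_i\Pi_j\Pi_i=\sigma^2\Pi_i$ for all $i\neq j$, and is a tight fusion frame for $\mathcal{E}$, meaning $\sum_{i=1}^n\Pi_i=aI$ for some $a>0$. Symmetry. A permutation $\sigma$ of $\{1,\dots,n\}$ is a symmetry of $(\mathcal{U}_i)_{i=1}^n$ if there is a unitary (orthogonal) map $\Upsilon_\sigma:\mathcal{E}\to\mathcal{E}$ such that $\Pi_{\sigma(i)}=\Upsilon_\sigma\Pi_i\Upsilon_\sigma^*$ for all $i$ (equivalently $\mathcal{U}_{\sigma(i)}=\Upsilon_\sigma(\mathcal{U}_i)$ for all $i$). The sequence is totally symmetric if every permutation in the symmetric group $S_n$ is a symmetry of it. The number $\rho_{\mathbb{R}}(r)$ is the classical real Radon–Hurwitz number: the maximum dimension of a subspace of $\mathbb{R}^{r\times r}$ whose every member is a scalar multiple of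 an orthogonal matrix. Its value is $8b+2^c$ by classical results. *)

theory Defs
  imports "HOL-Analysis.Analysis"
begin

definition orth_proj :: "'e::euclidean_space set \<Rightarrow> 'e \<Rightarrow> 'e" where
  "orth_proj U x = (THE y. y \<in> U \<and> x - y \<in> U\<^sup>\<bottom>)"

(* On subspaces the description above is proper; elsewhere orth_proj is never used. *)
lemma orth_proj_ex1:
  fixes U :: "'e::euclidean_space set"
  assumes "subspace U"
  shows "\<exists>!y. y \<in> U \<and> x - y \<in> U\<^sup>\<bottom>"
proof -
  have span: "span U = U"
    using assms by (simp add: span_eq_iff)
  obtain y z where yz: "y \<in> span U" "\<And>w. w \<in> span U \<Longrightarrow> orthogonal z w" "x = y + z"
    using orthogonal_subspace_decomp_exists by blast
  have ex: "y \<in> U \<and> x - y \<in> U\<^sup>\<bottom>"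
    using yz span by (auto simp: orthogonal_comp_def orthogonal_commute)
  have "y' = y''" if "y' \<in> U \<and> x - y' \<in> U\<^sup>\<bottom>" "y'' \<in> U \<and> x - y'' \<in> U\<^sup>\<bottom>" for y' y''
  proof -
    have "y' - y'' \<in> U"
      using that assms by (simp add: subspace_diff)
    moreover have "(x - y'') - (x - y') \<in> U\<^sup>\<bottom>"
      using that subspace_orthogonal_comp subspace_diff by blast
    ultimately have "orthogonal (y' - y'') (y' - y'')"
      by (simp add: orthogonal_comp_def)
    then show ?thesis
      by (simp add: orthogonal_def)
  qed
  with ex show ?thesis by blast
qed

lemma orth_proj:
  assumes "subspace U"
  shows "orth_proj U x \<in> U" "x - orth_proj U x \<in> U\<^sup>\<bottom>"
  using theI' [OF orth_proj_ex1 [OF assms], of x] by (auto simp: orth_proj_def)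

(* A sequence U_1, ..., U_n is a function on nat of which only the values on {1..n} matter. *)

definition equi_isoclinic :: "nat \<Rightarrow> (nat \<Rightarrow> 'e::euclidean_space set) \<Rightarrow> bool" where
  "equi_isoclinic n U \<longleftrightarrow>
     (\<exists>\<sigma>::real. \<sigma> \<ge> 0 \<and>
        (\<forall>i\<in>{1..n}. \<forall>j\<in>{1..n}. i \<noteq> j \<longrightarrow>
           (\<forall>x. orth_proj (U i) (orth_proj (U j) (orth_proj (U i) x)) =
                \<sigma>\<^sup>2 *\<^sub>R orth_proj (U i) x)))"

definition tight_fusion_frame :: "nat \<Rightarrow> (nat \<Rightarrow> 'e::euclidean_space set) \<Rightarrow> bool" where
  "tight_fusion_frame n U \<longleftrightarrow>
     (\<exists>a::real. a > 0 \<and> (\<forall>x. (\<Sum>i=1..n. orth_proj (U i) x) = a *\<^sub>R x))"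

definition EITFF :: "nat \<Rightarrow> nat \<Rightarrow> nat \<Rightarrow> (nat \<Rightarrow> 'e::euclidean_space set) \<Rightarrow> bool" where
  "EITFF d r n U \<longleftrightarrow>
     DIM('e) = d \<and> n \<ge> 2 \<and>
     (\<forall>i\<in>{1..n}. subspace (U i) \<and> dim (U i) = r) \<and>
     equi_isoclinic n U \<and> tight_fusion_frame n U"

definition is_symmetry :: "nat \<Rightarrow> (nat \<Rightarrow> 'e::euclidean_space set) \<Rightarrow> (nat \<Rightarrow> nat) \<Rightarrow> bool" where
  "is_symmetry n U \<sigma> \<longleftrightarrow>
     \<sigma> permutes {1..n} \<and>
     (\<exists>\<Upsilon> :: 'e \<Rightarrow> 'e. orthogonal_transformation \<Upsilon> \<and>
        (\<forall>i\<in>{1..n}. orth_proj (U (\<sigma> i)) = \<Upsilon> \<circ> orth_proj (U i) \<circ> adjoint \<Upsilon>))"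

definition totally_symmetric :: "nat \<Rightarrow> (nat \<Rightarrow> 'e::euclidean_space set) \<Rightarrow> bool" where
  "totally_symmetric n U \<longleftrightarrow> (\<forall>\<sigma>. \<sigma> permutes {1..n} \<longrightarrow> is_symmetry n U \<sigma>)"

(* The real Radon-Hurwitz number of r = CARD('r).  The dimensions are bounded by r^2, and the
   zero subspace shows there is at least one, so the maximum is a genuine one. *)
definition radon_hurwitz :: "'r::finite itself \<Rightarrow> nat" where
  "radon_hurwitz _ =
     Max {dim S | S :: (real^'r^'r) set.
            subspace S \<and>
            (\<forall>A\<in>S. \<exists>(t::real) Q. orthogonal_matrix Q \<and> A = t *\<^sub>R Q)}"

end

theory Submission
  imports Defs
begin

text \<open>In an EITFF of \<open>n = m + 1\<close> subspaces of half dimension, the reflections \<open>R\<^sub>i = 2 \<Pi>\<^sub>i - I\<close>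
  sum to zero and satisfy \<open>R\<^sub>i R\<^sub>j + R\<^sub>j R\<^sub>i = -2/m\<close>: they are the vertices of a regular simplex in
  the span of \<open>m\<close> pairwise anticommuting symmetric involutions \<open>E\<^sub>1, \<dots>, E\<^sub>m\<close> of \<open>\<real>\<^sup>2\<^sup>r\<close>. Conjugation
  by the normalised \<open>R\<^sub>i - R\<^sub>j\<close> is minus the transposition of \<open>R\<^sub>i\<close> and \<open>R\<^sub>j\<close>, so the EITFF is totally
  symmetric iff some orthogonal \<open>T\<close> anticommutes with all \<open>E\<^sub>i\<close>.

  Families \<open>E\<^sub>1, \<dots>, E\<^sub>m\<close> force powers of two to divide the dimension: eight of them cut out a
  subspace with sixteen times smaller dimension that is invariant under every operator anticommuting
  with all eight. This bounds the Radon--Hurwitz number from above, because a space of multiples of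
  orthogonal matrices \<open>A\<close> yields the anticommuting block matrices \<open>(0 A\<^sup>T; A 0)\<close> and \<open>(1 0; 0 -1)\<close>.
  For \<open>c = 3\<close> the operator \<open>T\<close> forces one more factor of two than \<open>2r\<close> has. Conversely, tensor
  products of \<open>2 \<times> 2\<close> matrices provide the families that are needed, and \<open>T\<close> if \<open>c \<le> 1\<close>.\<close>

section \<open>Divisibility of the dimension of Clifford modules\<close>

text \<open>An operator \<open>Q\<close> that anticommutes with the involution \<open>P\<close>
  exchanges its two eigenspaces in \<open>W\<close>. By injectivity these have equal dimension, and
  \<open>W\<close> is their direct sum. Asking only for injectivity allows a \<open>Q\<close> that
  is not an involution.\<close>

lemma halving:
  fixes P Q :: "'e::euclidean_space \<Rightarrow> 'e"
  assumes W: "subspace W" and P: "linear P" and Q: "linear Q"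
    and PW: "\<And>x. x \<in> W \<Longrightarrow> P x \<in> W" and QW: "\<And>x. x \<in> W \<Longrightarrow> Q x \<in> W"
    and PP: "\<And>x. P (P x) = x" and QP: "\<And>x. Q (P x) = - P (Q x)" and inj: "inj Q"
  shows "subspace {x \<in> W. P x = x}" and "dim W = 2 * dim {x \<in> W. P x = x}"
proof -
  let ?V = "{x \<in> W. P x = x}" and ?V' = "{x \<in> W. P x = - x}"
  show sV: "subspace ?V"
    using W P by (auto simp: subspace_def linear_add linear_scale linear_0)
  have sV': "subspace ?V'"
    using W P by (auto simp: subspace_def linear_add linear_scale linear_0)
  have "Q ` ?V \<subseteq> ?V'"
    using QW QP by (auto simp: equation_minus_iff)
  moreover have "Q ` ?V' \<subseteq> ?V"
  proof clarify
    fix x assume x: "x \<in> W" "P x = - x"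
    have "- Q x = - P (Q x)"
      using QP[of x] x linear_neg[OF Q, of x] by simp
    then show "Q x \<in> W \<and> P (Q x) = Q x"
      using QW x by simp
  qed
  moreover have "dim (Q ` ?V) = dim ?V" "dim (Q ` ?V') = dim ?V'"
    by (rule dim_image_eq[OF Q inj_on_subset[OF inj]]; simp)+
  ultimately have eq: "dim ?V = dim ?V'"
    using dim_subset[of "Q ` ?V" ?V'] dim_subset[of "Q ` ?V'" ?V] by linarith
  have "{x + y |x y. x \<in> ?V \<and> y \<in> ?V'} = W"
  proof safe
    fix x assume x: "x \<in> W"
    have "x = (1/2) *\<^sub>R (x + P x) + (1/2) *\<^sub>R (x - P x)"
      using scaleR_half_double[of x] by (simp add: scaleR_add_right scaleR_diff_right)
    moreover have "(1/2) *\<^sub>R (x + P x) \<in> ?V" "(1/2) *\<^sub>R (x - P x) \<in> ?V'"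
      using x PW PP W P
      by (auto simp: subspace_add subspace_diff subspace_scale linear_scale linear_add linear_diff algebra_simps)
    ultimately show "\<exists>u v. x = u + v \<and> u \<in> ?V \<and> v \<in> ?V'"
      by blast
  qed (use W subspace_add in blast)
  moreover have "?V \<inter> ?V' = {0}"
  proof -
    have "x = 0" if "x = - x" for x :: 'e
      using that by (simp add: eq_neg_iff_add_eq_0 flip: scaleR_2)
    then show ?thesis
      using W P by (auto simp: subspace_0 linear_0)
  qed
  ultimately show "dim W = 2 * dim ?V"
    using dim_sums_Int[OF sV sV'] eq by simp
qed

lemma inj_involution: "(\<And>x. f (f x) = x) \<Longrightarrow> inj f"
  by (metis injI)

text \<open>The four words below generate the extended Hamming code. Words of even length commute with
  every operator that anticommutes with all \<open>E i\<close>.\<close>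

lemma clifford_reduction_8:
  fixes E :: "nat \<Rightarrow> 'e::euclidean_space \<Rightarrow> 'e"
  assumes W: "subspace W"
    and lin: "\<And>i. i < 8 \<Longrightarrow> linear (E i)"
    and inv: "\<And>i x. i < 8 \<Longrightarrow> x \<in> W \<Longrightarrow> E i x \<in> W"
    and sq: "\<And>i x. i < 8 \<Longrightarrow> E i (E i x) = x"
    and ac: "\<And>i j x. i < 8 \<Longrightarrow> j < 8 \<Longrightarrow> i \<noteq> j \<Longrightarrow> E i (E j x) = - E j (E i x)"
  obtains V where "subspace V" "V \<subseteq> W" "dim W = 16 * dim V"
    "\<And>g x. linear g \<Longrightarrow> (\<And>x. x \<in> W \<Longrightarrow> g x \<in> W) \<Longrightarrow>
       (\<And>i x. i < 8 \<Longrightarrow> g (E i x) = - E i (g x)) \<Longrightarrow> x \<in> V \<Longrightarrow> g x \<in> V"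
proof -
  have neg: "\<And>i x. i < 8 \<Longrightarrow> E i (- x) = - E i x"
    by (simp add: lin linear_neg)
  \<comment> \<open>As a rewrite rule this sorts each word in the \<open>E i\<close> by increasing
    index from the outside in. Together with \<open>sq\<close> and \<open>neg\<close> it brings
    words to a signed normal form.\<close>
  have ord: "\<And>i j x. j < i \<Longrightarrow> i < 8 \<Longrightarrow> E i (E j x) = - E j (E i x)"
    by (rule ac; simp)
  note rw = neg ord sq
  define P where "P = E 0 \<circ> E 1 \<circ> E 2 \<circ> E 3"
  define P' where "P' = E 0 \<circ> E 1 \<circ> E 4 \<circ> E 5"
  define P'' where "P'' = E 0 \<circ> E 2 \<circ> E 4 \<circ> E 6"
  define P3 where "P3 = E 0 \<circ> E 1 \<circ> E 2 \<circ> E 3 \<circ> E 4 \<circ> E 5 \<circ> E 6 \<circ> E 7"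
  note Ps = P_def P'_def P''_def P3_def o_apply
  have linP: "linear P" "linear P'" "linear P''" "linear P3"
    unfolding P_def P'_def P''_def P3_def by (intro linear_compose lin; simp)+
  have injE: "inj (E i)" if "i < 8" for i
    using sq that by (intro inj_involution) auto
  have PE: "P (E 4 x) = E 4 (P x)" "P (E 6 x) = E 6 (P x)" "P (E 7 x) = E 7 (P x)"
    "P' (E 6 x) = E 6 (P' x)" "P' (E 7 x) = E 7 (P' x)" "P'' (E 7 x) = E 7 (P'' x)" for x
    by (simp_all add: Ps rw)
  have PP: "P (P' x) = P' (P x)" "P (P'' x) = P'' (P x)" "P (P3 x) = P3 (P x)"
    "P' (P'' x) = P'' (P' x)" "P' (P3 x) = P3 (P' x)" "P'' (P3 x) = P3 (P'' x)" for x
    by (simp_all add: Ps rw)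
  \<comment> \<open>A letter anticommutes with an even word that contains it and commutes with one
    that does not. Hence \<open>E 0\<close>, \<open>E 4\<close>, \<open>E 6\<close>,
    \<open>E 7\<close> each commute with the earlier involutions and anticommute with the next one:
    four halvings, a factor of \<open>16\<close>.\<close>
  have EP: "E 0 (P x) = - P (E 0 x)" "E 4 (P' x) = - P' (E 4 x)"
    "E 6 (P'' x) = - P'' (E 6 x)" "E 7 (P3 x) = - P3 (E 7 x)" for x
    by (simp_all add: Ps rw)
  have sqP: "P (P x) = x" "P' (P' x) = x" "P'' (P'' x) = x" "P3 (P3 x) = x" for x
    by (simp_all add: Ps rw)
  have PW: "P x \<in> W" "P' x \<in> W" "P'' x \<in> W" "P3 x \<in> W" if "x \<in> W" for x
    using that by (simp_all add: Ps inv)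
  note facts = PE PP sqP PW inv injE lin linP
  define V0 where "V0 = {x \<in> W. P x = x}"
  define V1 where "V1 = {x \<in> V0. P' x = x}"
  define V2 where "V2 = {x \<in> V1. P'' x = x}"
  define V3 where "V3 = {x \<in> V2. P3 x = x}"
  have V0: "subspace V0" "dim W = 2 * dim V0"
    unfolding V0_def
    by (rule halving[OF W, where Q = "E 0"]; simp add: facts EP)+
  have V1: "subspace V1" "dim V0 = 2 * dim V1"
    unfolding V1_def
    by (rule halving[OF V0(1), where Q = "E 4"]; simp add: V0_def EP facts)+
  have V2: "subspace V2" "dim V1 = 2 * dim V2"
    unfolding V2_def
    by (rule halving[OF V1(1), where Q = "E 6"]; simp add: V1_def V0_def EP facts)+
  have V3: "subspace V3" "dim V2 = 2 * dim V3"
    unfolding V3_def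
    by (rule halving[OF V2(1), where Q = "E 7"]; simp add: V2_def V1_def V0_def EP facts)+
  show ?thesis
  proof (rule that[OF V3(1)])
    show "V3 \<subseteq> W"
      by (auto simp: V3_def V2_def V1_def V0_def)
    show "dim W = 16 * dim V3"
      using V0 V1 V2 V3 by simp
    fix g :: "'e \<Rightarrow> 'e" and x
    assume g: "linear g" "\<And>x. x \<in> W \<Longrightarrow> g x \<in> W" "\<And>i x. i < 8 \<Longrightarrow> g (E i x) = - E i (g x)"
      and x: "x \<in> V3"
    have "g (P x) = P (g x)" "g (P' x) = P' (g x)" "g (P'' x) = P'' (g x)" "g (P3 x) = P3 (g x)"
      by (simp_all add: Ps g(3) rw)
    with x g show "g x \<in> V3"
      by (auto simp: V3_def V2_def V1_def V0_def)
  qed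
qed

text \<open>Induction over blocks of eight: each operator of the next block anticommutes with all
  earlier ones, so the invariance clause makes it act on the subspace cut out so far. The clause is
  part of the claim to keep this going and to carry over further operators later.\<close>

lemma clifford_reduction:
  fixes E :: "nat \<Rightarrow> 'e::euclidean_space \<Rightarrow> 'e"
  assumes lin: "\<And>i. i < 8 * B \<Longrightarrow> linear (E i)"
    and sq: "\<And>i x. i < 8 * B \<Longrightarrow> E i (E i x) = x"
    and ac: "\<And>i j x. i < 8 * B \<Longrightarrow> j < 8 * B \<Longrightarrow> i \<noteq> j \<Longrightarrow> E i (E j x) = - E j (E i x)"
  shows "\<exists>V. subspace V \<and> DIM('e) = 16 ^ B * dim V \<and>
    (\<forall>g. linear g \<longrightarrow> (\<forall>i<8 * B. \<forall>x. g (E i x) = - E i (g x)) \<longrightarrow> (\<forall>x\<in>V. g x \<in> V))"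
  using assms
proof (induction B)
  case 0
  show ?case
    by (rule exI[of _ UNIV]) simp
next
  case (Suc B)
  have IH: "\<exists>V. subspace V \<and> DIM('e) = 16 ^ B * dim V \<and>
    (\<forall>g. linear g \<longrightarrow> (\<forall>i<8 * B. \<forall>x. g (E i x) = - E i (g x)) \<longrightarrow> (\<forall>x\<in>V. g x \<in> V))"
  proof (rule Suc.IH)
    show "linear (E i)" if "i < 8 * B" for i
      using that by (intro Suc.prems(1)) simp
    show "E i (E i x) = x" if "i < 8 * B" for i x
      using that by (intro Suc.prems(2)) simp
    show "E i (E j x) = - E j (E i x)" if "i < 8 * B" "j < 8 * B" "i \<noteq> j" for i j x
      using that by (intro Suc.prems(3)) simp_all
  qed
  then obtain W where W: "subspace W" "DIM('e) = 16 ^ B * dim W"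
    "\<And>g x. linear g \<Longrightarrow> (\<And>i x. i < 8 * B \<Longrightarrow> g (E i x) = - E i (g x)) \<Longrightarrow> x \<in> W \<Longrightarrow> g x \<in> W"
    by metis
  let ?F = "\<lambda>i. E (8 * B + i)"
  have lin: "linear (?F i)" if "i < 8" for i
    using that by (intro Suc.prems(1)) simp
  have inv: "?F i x \<in> W" if "i < 8" "x \<in> W" for i x
  proof (rule W(3)[where g = "?F i"])
    show "?F i (E j y) = - E j (?F i y)" if "j < 8 * B" for j y
      using that \<open>i < 8\<close> by (intro Suc.prems(3)) simp_all
  qed (use that lin in simp_all)
  have sq: "?F i (?F i x) = x" if "i < 8" for i x
    using that by (intro Suc.prems(2)) simp
  have ac: "?F i (?F j x) = - ?F j (?F i x)" if "i < 8" "j < 8" "i \<noteq> j" for i j x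
    using that by (intro Suc.prems(3)) simp_all
  obtain V where V: "subspace V" "V \<subseteq> W" "dim W = 16 * dim V"
    "\<And>g x. linear g \<Longrightarrow> (\<And>x. x \<in> W \<Longrightarrow> g x \<in> W) \<Longrightarrow>
       (\<And>i x. i < 8 \<Longrightarrow> g (?F i x) = - ?F i (g x)) \<Longrightarrow> x \<in> V \<Longrightarrow> g x \<in> V"
    using clifford_reduction_8[of W ?F, OF W(1) lin inv sq ac] by blast
  show ?case
  proof (intro exI conjI allI impI ballI)
    show "subspace V" by (fact V(1))
    show "DIM('e) = 16 ^ Suc B * dim V"
      using W V by simp
    fix g :: "'e \<Rightarrow> 'e" and x
    assume g: "linear g" "\<forall>i<8 * Suc B. \<forall>x. g (E i x) = - E i (g x)" and x: "x \<in> V"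
    have "g y \<in> W" if "y \<in> W" for y
      by (rule W(3)[where g = g]) (use g that in simp_all)
    then show "g x \<in> V"
      by (rule V(4)[where g = g, rotated]) (use g x in simp_all)
  qed
qed

text \<open>\<open>J\<close> and \<open>K\<close> turn \<open>W\<close> into a quaternionic vector
  space. For \<open>v\<close> nonzero, the vectors \<open>v\<close>, \<open>J v\<close>,
  \<open>K v\<close>, \<open>J (K v)\<close> are orthogonal and span an invariant subspace; by
  skewness its orthogonal complement in \<open>W\<close> is invariant too, and induction on the
  dimension applies.\<close>

lemma quaternionic_dim:
  fixes J K :: "'e::euclidean_space \<Rightarrow> 'e"
  assumes W: "subspace W" and J: "linear J" and K: "linear K"
    and JW: "\<And>x. x \<in> W \<Longrightarrow> J x \<in> W" and KW: "\<And>x. x \<in> W \<Longrightarrow> K x \<in> W"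
    and skewJ: "\<And>x y. J x \<bullet> y = - (x \<bullet> J y)" and skewK: "\<And>x y. K x \<bullet> y = - (x \<bullet> K y)"
    and sqJ: "\<And>x. J (J x) = - x" and sqK: "\<And>x. K (K x) = - x"
    and JK: "\<And>x. K (J x) = - J (K x)"
  shows "4 dvd dim W"
  using W JW KW
proof (induction "dim W" arbitrary: W rule: less_induct)
  case less
  show ?case
  proof (cases "W \<subseteq> {0}")
    case True
    then show ?thesis
      by (simp flip: dim_eq_0)
  next
    case False
    then obtain v where v: "v \<in> W" "v \<noteq> 0" by auto
    let ?S = "{v, J v, K v, J (K v)}"
    have n: "J (- x) = - J x" "K (- x) = - K x" for x
      using J K by (simp_all add: linear_neg)
    have self: "x \<bullet> J x = 0" "x \<bullet> K x = 0" "J x \<bullet> x = 0" "K x \<bullet> x = 0" for x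
      using skewJ[of x x] skewK[of x x] by (simp_all add: inner_commute)
    have nrm: "J x \<bullet> J x = x \<bullet> x" "K x \<bullet> K x = x \<bullet> x" for x
      using skewJ[of x "J x"] skewK[of x "K x"] by (simp_all add: sqJ sqK)
    have jk: "x \<bullet> J (K x) = 0" for x
      using skewJ[of x "K x"] skewK[of "J x" x] self
      by (simp add: JK inner_commute)
    have jk': "J x \<bullet> K x = 0" "K x \<bullet> J x = 0" "J (K x) \<bullet> x = 0" for x
      using skewJ[of x "K x"] jk[of x] by (simp_all add: inner_commute)
    have a: "J x \<bullet> J (K x) = 0" "J (K x) \<bullet> J x = 0" "K x \<bullet> J (K x) = 0" "J (K x) \<bullet> K x = 0" for x
      using skewJ[of x "J (K x)"] self by (simp_all add: sqJ inner_commute)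
    have orth: "pairwise orthogonal ?S"
      by (auto simp: pairwise_def orthogonal_def self jk jk' a)
    have nz: "v \<bullet> v \<noteq> 0"
      using v by simp
    have nzs: "J v \<noteq> 0" "K v \<noteq> 0" "J (K v) \<noteq> 0"
      using v nrm by (metis inner_eq_zero_iff)+
    have ne: "v \<noteq> J v" "v \<noteq> K v" "v \<noteq> J (K v)" "J v \<noteq> K v" "J v \<noteq> J (K v)" "K v \<noteq> J (K v)"
      using self(1)[of v] self(2)[of v] jk[of v] jk'(1)[of v] a[of v] nz nzs
      by (metis inner_eq_zero_iff)+
    have dS: "dim (span ?S) = 4"
      using pairwise_orthogonal_independent[OF orth] nzs ne v
      by (simp add: dim_eq_card_independent)
    have SW: "span ?S \<subseteq> W"
      using v less.prems by (intro span_minimal) auto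
    let ?U = "{y \<in> W. \<forall>x\<in>span ?S. orthogonal x y}"
    have sU: "subspace ?U"
      using less.prems(1) by (auto simp: subspace_def orthogonal_def inner_add_right)
    have dU: "dim ?U + 4 = dim W"
      using dim_subspace_orthogonal_to_vectors[OF subspace_span less.prems(1) SW] dS
      by (simp add: orthogonal_commute)
    have S: "J ` ?S \<subseteq> span ?S" "K ` ?S \<subseteq> span ?S"
      by (simp_all add: sqJ sqK JK n span_base span_neg)
    have inv: "J x \<in> span ?S" "K x \<in> span ?S" if "x \<in> span ?S" for x
      using imageI[OF that, of J] imageI[OF that, of K]
        span_minimal[OF S(1) subspace_span] span_minimal[OF S(2) subspace_span]
      by (simp_all only: linear_span_image[OF J] linear_span_image[OF K] subset_iff)
    have "4 dvd dim ?U"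
    proof (rule less.hyps)
      show "dim ?U < dim W" using dU by linarith
      fix x assume x: "x \<in> ?U"
      have "s \<bullet> J x = 0" "s \<bullet> K x = 0" if "s \<in> span ?S" for s
        using inv[OF that] x skewJ[of s x] skewK[of s x] by (simp_all add: orthogonal_def)
      then show "J x \<in> ?U" "K x \<in> ?U"
        using x less.prems by (simp_all add: orthogonal_def)
    qed (rule sU)
    then show ?thesis
      by (simp flip: dU)
  qed
qed

section \<open>Self-adjoint modules over the real Clifford algebra with generators of square
  1\<close>

definition clifford :: "nat \<Rightarrow> (nat \<Rightarrow> 'e::euclidean_space \<Rightarrow> 'e) \<Rightarrow> bool" where
  "clifford m E \<longleftrightarrow>
     (\<forall>i<m. linear (E i) \<and> (\<forall>x. E i (E i x) = x) \<and> (\<forall>x y. E i x \<bullet> y = x \<bullet> E i y)) \<and>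
     (\<forall>i<m. \<forall>j<m. i \<noteq> j \<longrightarrow> (\<forall>x. E i (E j x) = - E j (E i x)))"

lemma cliffordD:
  assumes "clifford m E" "i < m"
  shows "linear (E i)" "E i (E i x) = x" "E i x \<bullet> y = x \<bullet> E i y"
    and "j < m \<Longrightarrow> i \<noteq> j \<Longrightarrow> E i (E j x) = - E j (E i x)"
  using assms unfolding clifford_def by blast+

text \<open>The generators after the first \<open>8 * B\<close> anticommute with those, hence act on
  the reduced subspace. What remains is a problem about \<open>k\<close> generators in a dimension
  smaller by the factor \<open>16 ^ B\<close>.\<close>

lemma clifford_core:
  fixes E :: "nat \<Rightarrow> 'e::euclidean_space \<Rightarrow> 'e"
  assumes E: "clifford (8 * B + k) E"
  obtains V where "subspace V" "DIM('e) = 16 ^ B * dim V"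
    "\<And>i x. i < k \<Longrightarrow> x \<in> V \<Longrightarrow> E (8 * B + i) x \<in> V"
    "\<And>T x. linear T \<Longrightarrow> (\<And>i x. i < 8 * B \<Longrightarrow> T (E i x) = - E i (T x)) \<Longrightarrow> x \<in> V \<Longrightarrow> T x \<in> V"
proof -
  note ED = cliffordD[OF E]
  have "\<exists>V. subspace V \<and> DIM('e) = 16 ^ B * dim V \<and>
    (\<forall>g. linear g \<longrightarrow> (\<forall>i<8 * B. \<forall>x. g (E i x) = - E i (g x)) \<longrightarrow> (\<forall>x\<in>V. g x \<in> V))"
    by (rule clifford_reduction) (rule ED; simp)+
  then obtain V where V: "subspace V" "DIM('e) = 16 ^ B * dim V"
    "\<And>g x. linear g \<Longrightarrow> (\<And>i x. i < 8 * B \<Longrightarrow> g (E i x) = - E i (g x)) \<Longrightarrow> x \<in> V \<Longrightarrow> g x \<in> V"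
    by metis
  have "E (8 * B + i) x \<in> V" if "i < k" "x \<in> V" for i x
  proof (rule V(3)[where g = "E (8 * B + i)"])
    show "E (8 * B + i) (E j y) = - E j (E (8 * B + i) y)" if "j < 8 * B" for j y
      using that \<open>i < k\<close> by (intro ED(4)) simp_all
  qed (use that in \<open>simp_all add: ED\<close>)
  with V show ?thesis
    using that by blast
qed

text \<open>One generator survives the reduction, and \<open>T\<close> exchanges its eigenspaces in
  the reduced subspace, whose dimension is therefore even. This is the obstruction for
  \<open>c = 3\<close>.\<close>

lemma clifford_twist_dvd:
  fixes E :: "nat \<Rightarrow> 'e::euclidean_space \<Rightarrow> 'e"
  assumes E: "clifford (8 * B + 1) E" and T: "linear T" "inj T"
    and TE: "\<And>i x. i < 8 * B + 1 \<Longrightarrow> T (E i x) = - E i (T x)"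
  shows "2 * 16 ^ B dvd DIM('e)"
proof -
  obtain V where V: "subspace V" "DIM('e) = 16 ^ B * dim V"
    and VE: "\<And>i x. i < 1 \<Longrightarrow> x \<in> V \<Longrightarrow> E (8 * B + i) x \<in> V"
    and VT: "\<And>T x. linear T \<Longrightarrow> (\<And>i x. i < 8 * B \<Longrightarrow> T (E i x) = - E i (T x)) \<Longrightarrow> x \<in> V \<Longrightarrow> T x \<in> V"
    using clifford_core[OF E] by blast
  have "T x \<in> V" if "x \<in> V" for x
    using that T TE by (intro VT[where T = T]) simp_all
  then have "dim V = 2 * dim {x \<in> V. E (8 * B) x = x}"
    using V T TE VE[of 0] cliffordD[OF E, of "8 * B"]
    by (intro halving[where Q = T]) simp_all
  then show ?thesis
    using V(2) by simp
qed

text \<open>On the reduced subspace two generators give one halving, and three give the quaternionic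
  structure \<open>F 0 \<circ> F 1\<close>, \<open>F 1 \<circ> F 2\<close>. Words of four letters
  are involutions: with four generators one halving by such a word precedes the quaternionic
  structure, with six generators two halvings do.\<close>

lemma clifford_dvd:
  fixes E :: "nat \<Rightarrow> 'e::euclidean_space \<Rightarrow> 'e"
  shows "clifford (8 * B + 2) E \<Longrightarrow> 2 * 16 ^ B dvd DIM('e)"
    and "clifford (8 * B + 3) E \<Longrightarrow> 4 * 16 ^ B dvd DIM('e)"
    and "clifford (8 * B + 4) E \<Longrightarrow> 8 * 16 ^ B dvd DIM('e)"
    and "clifford (8 * B + 6) E \<Longrightarrow> 16 * 16 ^ B dvd DIM('e)"
proof -
  define F where "F i = E (8 * B + i)" for i
  have core: "\<exists>V. subspace V \<and> DIM('e) = 16 ^ B * dim V \<and> (\<forall>i<k. \<forall>x\<in>V. F i x \<in> V)"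
    and lin: "i < k \<Longrightarrow> linear (F i)"
    and sq: "i < k \<Longrightarrow> F i (F i x) = x"
    and sym: "i < k \<Longrightarrow> F i x \<bullet> y = x \<bullet> F i y"
    and neg: "i < k \<Longrightarrow> F i (- x) = - F i x"
    and ord: "j < i \<Longrightarrow> i < k \<Longrightarrow> F i (F j x) = - F j (F i x)"
    if E: "clifford (8 * B + k) E" for k i j x y
  proof -
    show "\<exists>V. subspace V \<and> DIM('e) = 16 ^ B * dim V \<and> (\<forall>i<k. \<forall>x\<in>V. F i x \<in> V)"
      unfolding F_def by (rule clifford_core[OF E]) blast
    show lin: "linear (F i)" if "i < k"
      using cliffordD(1)[OF E, of "8 * B + i"] that by (simp add: F_def)
    show "F i (F i x) = x" if "i < k"
      using cliffordD(2)[OF E, of "8 * B + i"] that by (simp add: F_def)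
    show "F i x \<bullet> y = x \<bullet> F i y" if "i < k"
      using cliffordD(3)[OF E, of "8 * B + i"] that by (simp add: F_def)
    show "F i (- x) = - F i x" if "i < k"
      using lin that by (simp add: linear_neg)
    show "F i (F j x) = - F j (F i x)" if "j < i" "i < k"
      using cliffordD(4)[OF E, of "8 * B + i" "8 * B + j"] that by (simp add: F_def)
  qed
  show "2 * 16 ^ B dvd DIM('e)" if E: "clifford (8 * B + 2) E"
  proof -
    obtain V where V: "subspace V" "DIM('e) = 16 ^ B * dim V" "\<And>i x. i < 2 \<Longrightarrow> x \<in> V \<Longrightarrow> F i x \<in> V"
      using core[OF E] by metis
    have "inj (F 1)"
      by (rule inj_involution) (simp add: sq[OF E])
    then have "dim V = 2 * dim {x \<in> V. F 0 x = x}"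
      by (intro halving[where Q = "F 1"]) (simp_all add: V lin[OF E] sq[OF E] ord[OF E])
    then show ?thesis
      using V(2) by simp
  qed
  show "4 * 16 ^ B dvd DIM('e)" if E: "clifford (8 * B + 3) E"
  proof -
    note rw = sq[OF E] sym[OF E] neg[OF E] ord[OF E]
    obtain V where V: "subspace V" "DIM('e) = 16 ^ B * dim V" "\<And>i x. i < 3 \<Longrightarrow> x \<in> V \<Longrightarrow> F i x \<in> V"
      using core[OF E] by metis
    have "linear (F 0 \<circ> F 1)" "linear (F 1 \<circ> F 2)"
      by (intro linear_compose lin[OF E]; simp)+
    then have "4 dvd dim V"
      by (rule quaternionic_dim[OF V(1)]) (simp_all add: rw V)
    then show ?thesis
      using V(2) by simp
  qed
  show "8 * 16 ^ B dvd DIM('e)" if E: "clifford (8 * B + 4) E"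
  proof -
    note rw = sq[OF E] sym[OF E] neg[OF E] ord[OF E]
    obtain V where V: "subspace V" "DIM('e) = 16 ^ B * dim V" "\<And>i x. i < 4 \<Longrightarrow> x \<in> V \<Longrightarrow> F i x \<in> V"
      using core[OF E] by metis
    define P where "P = F 0 \<circ> F 1 \<circ> F 2 \<circ> F 3"
    have P: "linear P"
      unfolding P_def by (intro linear_compose lin[OF E]; simp)
    have inj: "inj (F 0)"
      by (rule inj_involution) (simp add: sq[OF E])
    have comm: "P (F 0 (F 1 x)) = F 0 (F 1 (P x))" "P (F 1 (F 2 x)) = F 1 (F 2 (P x))"
      "P (P x) = x" "F 0 (P x) = - P (F 0 x)" for x
      by (simp_all add: P_def rw)
    have PV: "P x \<in> V" if "x \<in> V" for x
      using that by (simp add: P_def V)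
    define V' where "V' = {x \<in> V. P x = x}"
    have V': "subspace V'" "dim V = 2 * dim V'"
      unfolding V'_def
      by (rule halving[OF V(1), where Q = "F 0"]; simp add: V P lin[OF E] inj comm PV)+
    have "linear (F 0 \<circ> F 1)" "linear (F 1 \<circ> F 2)"
      by (intro linear_compose lin[OF E]; simp)+
    then have "4 dvd dim V'"
      by (rule quaternionic_dim[OF V'(1)]; (simp add: V V'_def comm[unfolded One_nat_def])?; (simp add: rw)?)
    then show ?thesis
      using V(2) V'(2) by simp
  qed
  show "16 * 16 ^ B dvd DIM('e)" if E: "clifford (8 * B + 6) E"
  proof -
    note rw = sq[OF E] sym[OF E] neg[OF E] ord[OF E]
    obtain V where V: "subspace V" "DIM('e) = 16 ^ B * dim V" "\<And>i x. i < 6 \<Longrightarrow> x \<in> V \<Longrightarrow> F i x \<in> V"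
      using core[OF E] by metis
    define P where "P = F 0 \<circ> F 1 \<circ> F 2 \<circ> F 3"
    define P' where "P' = F 0 \<circ> F 1 \<circ> F 4 \<circ> F 5"
    have P: "linear P" "linear P'"
      unfolding P_def P'_def by (intro linear_compose lin[OF E]; simp)+
    have inj: "inj (F 0)" "inj (F 4)"
      by (rule inj_involution; simp add: sq[OF E])+
    have comm: "P (F 0 (F 1 x)) = F 0 (F 1 (P x))" "P (F 0 (F 2 (F 4 x))) = F 0 (F 2 (F 4 (P x)))"
      "P' (F 0 (F 1 x)) = F 0 (F 1 (P' x))" "P' (F 0 (F 2 (F 4 x))) = F 0 (F 2 (F 4 (P' x)))"
      "P (F 4 x) = F 4 (P x)" "P (P' x) = P' (P x)"
      "P (P x) = x" "P' (P' x) = x" "F 0 (P x) = - P (F 0 x)" "F 4 (P' x) = - P' (F 4 x)" for x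
      by (simp_all add: P_def P'_def rw)
    have PV: "P x \<in> V" "P' x \<in> V" if "x \<in> V" for x
      using that by (simp_all add: P_def P'_def V)
    define V' where "V' = {x \<in> V. P x = x}"
    have V': "subspace V'" "dim V = 2 * dim V'"
      unfolding V'_def
      by (rule halving[OF V(1), where Q = "F 0"]; simp add: V P lin[OF E] inj comm PV)+
    define V'' where "V'' = {x \<in> V'. P' x = x}"
    have V'': "subspace V''" "dim V' = 2 * dim V''"
      unfolding V''_def
      by (rule halving[OF V'(1), where Q = "F 4"]; simp add: V P lin[OF E] inj comm PV V'_def)+
    \<comment> \<open>The word \<open>F 1 \<circ> F 2\<close> anticommutes with \<open>P'\<close>.
      The word \<open>F 0 \<circ> F 2 \<circ> F 4\<close> shares two letters with each of
      \<open>P\<close> and \<open>P'\<close> and so commutes with both; it is skew with square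
      \<open>-1\<close> and anticommutes with \<open>F 0 \<circ> F 1\<close>.\<close>
    have "linear (F 0 \<circ> F 1)" "linear (F 0 \<circ> F 2 \<circ> F 4)"
      by (intro linear_compose lin[OF E]; simp)+
    then have "4 dvd dim V''"
      by (rule quaternionic_dim[OF V''(1)]; (simp add: V V'_def V''_def comm[unfolded One_nat_def])?; (simp add: rw)?)
    then show ?thesis
      using V(2) V'(2) V''(2) by simp
  qed
qed

section \<open>Equi-isoclinic tight fusion frames and simplices of involutions\<close>

lemma orth_proj_eqI:
  assumes "subspace U" "y \<in> U" "\<And>u. u \<in> U \<Longrightarrow> (x - y) \<bullet> u = 0"
  shows "orth_proj U x = y"
proof -
  have "y \<in> U \<and> x - y \<in> U\<^sup>\<bottom>"
    using assms by (auto simp: orthogonal_comp_def orthogonal_def inner_commute)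
  then show ?thesis
    using orth_proj_ex1[OF assms(1), of x] orth_proj[OF assms(1), of x] by blast
qed

lemma orth_proj_perp:
  assumes "subspace U" "u \<in> U"
  shows "(x - orth_proj U x) \<bullet> u = 0" "u \<bullet> (x - orth_proj U x) = 0"
  using orth_proj(2)[OF assms(1), of x] assms(2)
  by (auto simp: orthogonal_comp_def orthogonal_def inner_commute)

lemma orth_proj_mem: "subspace U \<Longrightarrow> x \<in> U \<Longrightarrow> orth_proj U x = x"
  by (rule orth_proj_eqI) auto

lemma linear_orth_proj:
  assumes U: "subspace U"
  shows "linear (orth_proj U)"
proof
  note m = orth_proj(1)[OF U] and p = orth_proj_perp[OF U]
  show "orth_proj U (x + y) = orth_proj U x + orth_proj U y" for x y
  proof (rule orth_proj_eqI[OF U])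
    show "(x + y - (orth_proj U x + orth_proj U y)) \<bullet> u = 0" if "u \<in> U" for u
      using p(1)[OF that, of x] p(1)[OF that, of y] by (simp add: inner_diff_left inner_add_left)
  qed (simp add: m U subspace_add)
  show "orth_proj U (c *\<^sub>R x) = c *\<^sub>R orth_proj U x" for c x
  proof (rule orth_proj_eqI[OF U])
    show "(c *\<^sub>R x - c *\<^sub>R orth_proj U x) \<bullet> u = 0" if "u \<in> U" for u
      using p(1)[OF that, of x] by (simp flip: scaleR_diff_right)
  qed (simp add: m U subspace_scale)
qed

lemma orth_proj_self_adjoint:
  assumes U: "subspace U"
  shows "orth_proj U x \<bullet> y = x \<bullet> orth_proj U y"
  using orth_proj_perp(1)[OF U orth_proj(1)[OF U, of y], of x]
    orth_proj_perp(2)[OF U orth_proj(1)[OF U, of x], of y]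
  by (simp add: inner_diff_left inner_diff_right)

text \<open>Expanding the projection in an orthonormal basis of \<open>U\<close> and swapping the
  sums leaves the sum of the squared norms of the basis vectors. The trace later determines the
  frame constant.\<close>

lemma trace_orth_proj:
  fixes U :: "'e::euclidean_space set"
  assumes U: "subspace U"
  shows "(\<Sum>b\<in>Basis. b \<bullet> orth_proj U b) = dim U"
proof -
  obtain B where B: "B \<subseteq> U" "pairwise orthogonal B" "\<And>x. x \<in> B \<Longrightarrow> norm x = 1"
    "independent B" "card B = dim U" "span B = U"
    using orthonormal_basis_subspace[OF U] by blast
  have fin: "finite B"
    using B(4) independent_imp_finite by blast
  have cc: "c \<bullet> c' = (if c = c' then 1 else 0)" if "c \<in> B" "c' \<in> B" for c c'
    using B(2,3) that by (auto simp: pairwise_def orthogonal_def dot_square_norm)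
  have proj: "orth_proj U x = (\<Sum>c\<in>B. (x \<bullet> c) *\<^sub>R c)" for x
  proof (rule orth_proj_eqI[OF U])
    show "(\<Sum>c\<in>B. (x \<bullet> c) *\<^sub>R c) \<in> U"
      using B(1) U by (intro subspace_sum subspace_scale) auto
    fix u assume "u \<in> U"
    moreover have "span B \<subseteq> {u. (x - (\<Sum>c\<in>B. (x \<bullet> c) *\<^sub>R c)) \<bullet> u = 0}"
    proof (rule span_minimal)
      show "subspace {u. (x - (\<Sum>c\<in>B. (x \<bullet> c) *\<^sub>R c)) \<bullet> u = 0}"
        by (rule subspace_hyperplane)
      show "B \<subseteq> {u. (x - (\<Sum>c\<in>B. (x \<bullet> c) *\<^sub>R c)) \<bullet> u = 0}"
        using fin by (auto simp: inner_diff_left inner_sum_left cc if_distrib cong: if_cong)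
    qed
    ultimately show "(x - (\<Sum>c\<in>B. (x \<bullet> c) *\<^sub>R c)) \<bullet> u = 0"
      using B(6) by blast
  qed
  have "(\<Sum>b\<in>Basis. b \<bullet> orth_proj U b) = (\<Sum>b\<in>Basis. \<Sum>c\<in>B. (c \<bullet> b) * (c \<bullet> b))"
    by (simp add: proj inner_sum_right inner_commute)
  also have "\<dots> = (\<Sum>c\<in>B. c \<bullet> c)"
    by (subst sum.swap) (simp flip: euclidean_inner)
  also have "\<dots> = dim U"
    using B(5) cc by simp
  finally show ?thesis .
qed

text \<open>The adjoint of an orthogonal map is its inverse, so a symmetry can be handled as an
  intertwining relation free of adjoints.\<close>

lemma conj_orthogonal_iff:
  fixes T :: "'e::euclidean_space \<Rightarrow> 'e"
  assumes T: "orthogonal_transformation T"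
  shows "P' = T \<circ> P \<circ> adjoint T \<longleftrightarrow> (\<forall>x. P' (T x) = T (P x))"
proof -
  have lin: "linear T"
    using T by (simp add: orthogonal_transformation_def)
  have *: "adjoint T (T x) = x" for x
  proof -
    have "adjoint T (T x) \<bullet> y = x \<bullet> y" for y
      using T adjoint_clauses(2)[OF lin, of "T x" y] by (simp add: orthogonal_transformation_def)
    then show ?thesis
      by (meson vector_eq_rdot)
  qed
  have **: "T (adjoint T x) = x" for x
    using orthogonal_transformation_surj[OF T] * by (metis surjD)
  show ?thesis
    by (auto simp: fun_eq_iff *) (metis **)
qed

text \<open>With half the anticommutator read as an inner product, the \<open>R i\<close> are the
  unit vertices of a regular simplex centred at the origin. Given that all anticommutators are the
  same scalar, the vanishing sum forces its value.\<close>

definition simplex_involutions :: "nat \<Rightarrow> (nat \<Rightarrow> 'e::euclidean_space \<Rightarrow> 'e) \<Rightarrow> bool" where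
  "simplex_involutions n R \<longleftrightarrow>
     (\<forall>i\<in>{1..n}. linear (R i) \<and> (\<forall>x. R i (R i x) = x) \<and> (\<forall>x y. R i x \<bullet> y = x \<bullet> R i y)) \<and>
     (\<forall>i\<in>{1..n}. \<forall>j\<in>{1..n}. i \<noteq> j \<longrightarrow>
        (\<forall>x. R i (R j x) + R j (R i x) = (- 2 / (real n - 1)) *\<^sub>R x)) \<and>
     (\<forall>x. (\<Sum>i=1..n. R i x) = 0)"

lemma simplex_involutionsD:
  assumes "simplex_involutions n R" "i \<in> {1..n}"
  shows "linear (R i)" "R i (R i x) = x" "R i x \<bullet> y = x \<bullet> R i y"
    and "j \<in> {1..n} \<Longrightarrow> i \<noteq> j \<Longrightarrow> R i (R j x) + R j (R i x) = (- 2 / (real n - 1)) *\<^sub>R x"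
    and "(\<Sum>i=1..n. R i y) = 0"
  using assms unfolding simplex_involutions_def by blast+

text \<open>The Clifford form of a reflection: \<open>R i - R j\<close> is orthogonal to every other
  vertex and so anticommutes with it, while it exchanges \<open>R i\<close> and \<open>R j\<close>
  up to sign. Its square is a positive scalar, so it can be normalised to an involution.\<close>

lemma simplex_difference:
  assumes R: "simplex_involutions n R" and ij: "i \<in> {1..n}" "j \<in> {1..n}" "i \<noteq> j"
  shows "k \<in> {1..n} \<Longrightarrow>
      R (Transposition.transpose i j k) (R i x - R j x) = - (R i (R k x) - R j (R k x))"
    and "R i (R i x - R j x) - R j (R i x - R j x) = (2 + 2 / (real n - 1)) *\<^sub>R x"
proof -
  note D = simplex_involutionsD[OF R]
  have lin: "R k (x - y) = R k x - R k y" if "k \<in> {1..n}" for k x y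
    using D(1)[OF that] by (simp add: linear_diff)
  have comm: "R a (R b x) = (- 2 / (real n - 1)) *\<^sub>R x - R b (R a x)"
    if "a \<in> {1..n}" "b \<in> {1..n}" "a \<noteq> b" for a b x
    using D(4)[OF that(1,2,3), of x] by (simp add: algebra_simps)
  show "R (Transposition.transpose i j k) (R i x - R j x) = - (R i (R k x) - R j (R k x))" if "k \<in> {1..n}"
  proof -
    consider "k = i" | "k = j" | "k \<noteq> i" "k \<noteq> j" by blast
    then show ?thesis
    proof cases
      case 3
      then show ?thesis
        using comm[OF that ij(1), of x] comm[OF that ij(2), of x] by (simp add: lin[OF that])
    qed (simp_all add: lin[OF ij(1)] lin[OF ij(2)] D(2)[OF ij(1)] D(2)[OF ij(2)])
  qed
  show "R i (R i x - R j x) - R j (R i x - R j x) = (2 + 2 / (real n - 1)) *\<^sub>R x"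
    using comm[OF ij, of x]
    by (simp add: lin[OF ij(1)] lin[OF ij(2)] D(2)[OF ij(1)] D(2)[OF ij(2)] scaleR_2 algebra_simps)
qed

text \<open>The frame consists of the eigenspaces for \<open>1\<close>, of half dimension because
  \<open>T\<close> exchanges the two eigenspaces of each \<open>R i\<close>. Since transpositions
  generate all permutations, it is enough to realise each of them, by a normalised
  \<open>R i - R j\<close> composed with \<open>T\<close>.\<close>

lemma eitff_of_simplex_involutions:
  fixes R :: "nat \<Rightarrow> 'e::euclidean_space \<Rightarrow> 'e"
  assumes R: "simplex_involutions n R" and n: "n \<ge> 2" and dim: "DIM('e) = 2 * r"
    and T: "orthogonal_transformation T"
    and TR: "\<And>i x. i \<in> {1..n} \<Longrightarrow> T (R i x) = - R i (T x)"
  shows "\<exists>U :: nat \<Rightarrow> 'e set. EITFF (2 * r) r n U \<and> totally_symmetric n U"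
proof -
  define U where "U i = {x \<in> UNIV. R i x = x}" for i
  note D = simplex_involutionsD[OF R]
  have linT: "linear T" and TT: "T x \<bullet> T y = x \<bullet> y" for x y
    using T by (simp_all add: orthogonal_transformation_def)
  have U: "subspace (U i)" "DIM('e) = 2 * dim (U i)" if "i \<in> {1..n}" for i
    using halving[of UNIV "R i" T] D(1,2)[OF that] TR[OF that] linT
      orthogonal_transformation_inj[OF T]
    by (simp_all add: U_def)
  have lin: "R i (x + y) = R i x + R i y" "R i (x - y) = R i x - R i y"
    "R i (c *\<^sub>R x) = c *\<^sub>R R i x" "R i (- x) = - R i x" if "i \<in> {1..n}" for i x y c
    using D(1)[OF that] by (simp_all add: linear_add linear_diff linear_scale linear_neg)
  have P: "orth_proj (U i) x = (1/2) *\<^sub>R (x + R i x)" if i: "i \<in> {1..n}" for i x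
  proof (rule orth_proj_eqI[OF U(1)[OF i]])
    show "(1/2) *\<^sub>R (x + R i x) \<in> U i"
      using D(2)[OF i] by (simp add: U_def lin[OF i] add.commute)
    fix u assume "u \<in> U i"
    then have "R i x \<bullet> u = x \<bullet> u"
      using D(3)[OF i, of x u] by (simp add: U_def)
    then show "(x - (1/2) *\<^sub>R (x + R i x)) \<bullet> u = 0"
      by (simp add: inner_diff_left inner_add_left)
  qed
  \<comment> \<open>With \<open>P i = (1 + R i) / 2\<close>, the product \<open>P i P j P i\<close>
    expands to \<open>(1/8) (2 - 2 / (n - 1)) (1 + R i)\<close>, and \<open>1 + R i\<close> is twice
    \<open>P i\<close>.\<close>
  define \<sigma> where "\<sigma> = sqrt ((1 - 1 / (real n - 1)) / 2)"
  have \<sigma>: "\<sigma> \<ge> 0" "\<sigma>\<^sup>2 = (1 - 1 / (real n - 1)) / 2"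
    using n by (simp_all add: \<sigma>_def)
  have "orth_proj (U i) (orth_proj (U j) (orth_proj (U i) x)) = \<sigma>\<^sup>2 *\<^sub>R orth_proj (U i) x"
    if ij: "i \<in> {1..n}" "j \<in> {1..n}" "i \<noteq> j" for i j x
  proof -
    have c: "R j (R i y) = (- 2 / (real n - 1)) *\<^sub>R y - R i (R j y)" for y
      using D(4)[OF ij, of y] by (simp add: algebra_simps)
    have e: "1 / 8 * (2 - 2 / t) = (1 - 1 / t) / 2 * (1 / 2)" for t :: real
      by (cases "t = 0") (simp_all add: field_simps)
    have "orth_proj (U i) (orth_proj (U j) (orth_proj (U i) x)) =
      (1/8) *\<^sub>R (2 *\<^sub>R x + 2 *\<^sub>R R i x + R j x + (R j (R i x) + R i (R j x)) + R i (R j (R i x)))"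

      by (simp add: P[OF ij(1)] P[OF ij(2)] lin[OF ij(1)] lin[OF ij(2)] D(2)[OF ij(1)] scaleR_2 algebra_simps)
    also have "\<dots> = (1/8) *\<^sub>R ((2 - 2 / (real n - 1)) *\<^sub>R (x + R i x))"
      unfolding c by (simp add: lin[OF ij(1)] D(2)[OF ij(1)] algebra_simps)
    also have "\<dots> = \<sigma>\<^sup>2 *\<^sub>R orth_proj (U i) x"
      unfolding P[OF ij(1)] scaleR_scaleR \<sigma>(2) by (simp only: e)
    finally show ?thesis .
  qed
  then have iso: "equi_isoclinic n U"
    unfolding equi_isoclinic_def using \<sigma>(1) by blast
  have "(\<Sum>i=1..n. orth_proj (U i) x) = (real n / 2) *\<^sub>R x" for x
  proof -
    have "(\<Sum>i=1..n. orth_proj (U i) x) = (\<Sum>i=1..n. (1/2) *\<^sub>R (x + R i x))"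
      by (simp add: P)
    also have "\<dots> = (1/2) *\<^sub>R (\<Sum>i=1..n. x + R i x)"
      by (simp only: scaleR_sum_right)
    also have "\<dots> = (real n / 2) *\<^sub>R x"
      using D(5)[of 1 x] n by (simp add: sum.distrib sum_constant_scaleR del: sum_constant)
    finally show ?thesis .
  qed
  then have tff: "tight_fusion_frame n U"
    unfolding tight_fusion_frame_def using n by (intro exI[of _ "real n / 2"]) simp
  have eitff: "EITFF (2 * r) r n U"
    using U dim n iso tff by (simp add: EITFF_def)
  have "is_symmetry n U s" if "s permutes {1..n}" for s
    using that finite_atLeastAtMost
  proof (induction s rule: permutes_induct)
    case id
    show ?case
      unfolding is_symmetry_def
      by (auto simp: permutes_id conj_orthogonal_iff orthogonal_transformation_id
          intro!: exI[of _ "\<lambda>x. x"])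
  next
    case (swap i j p)
    note ij = swap.hyps(1-3)
    obtain V where V: "orthogonal_transformation V"
      "\<And>k x. k \<in> {1..n} \<Longrightarrow> orth_proj (U (p k)) (V x) = V (orth_proj (U k) x)"
      using swap.IH conj_orthogonal_iff unfolding is_symmetry_def by metis
    define l where "l = 1 / sqrt (2 + 2 / (real n - 1))"
    have l: "l * (l * (2 + 2 / (real n - 1))) = 1"
      using n by (simp add: l_def flip: power2_eq_square mult.assoc) (simp add: power_divide field_simps)
    define S where "S x = l *\<^sub>R (R i x - R j x)" for x
    have linS: "linear S"
      unfolding S_def using D(1) ij by (intro linear_compose_scale_right linear_compose_sub) auto
    have SS: "S (S x) = x" for x
      using simplex_difference(2)[OF R ij, of x] l
      by (simp add: S_def lin[OF ij(1)] lin[OF ij(2)] flip: scaleR_diff_right)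
    have "S x \<bullet> y = x \<bullet> S y" for x y
      using D(3) ij by (simp add: S_def inner_diff_left inner_diff_right)
    then have "orthogonal_transformation S"
      using linS SS by (simp add: orthogonal_transformation_def)
    then have orth: "orthogonal_transformation (S \<circ> T \<circ> V)"
      by (intro orthogonal_transformation_compose T V)
    have "orth_proj (U ((Transposition.transpose i j \<circ> p) k)) ((S \<circ> T \<circ> V) x) = (S \<circ> T \<circ> V) (orth_proj (U k) x)"
      if k: "k \<in> {1..n}" for k x
    proof -
      have pk: "p k \<in> {1..n}"
        using swap.hyps(4) k by (simp only: permutes_in_image)
      have tk: "Transposition.transpose i j (p k) \<in> {1..n}"
        using pk ij by (simp add: Transposition.transpose_def)
      have "R (Transposition.transpose i j (p k)) (S y) = - S (R (p k) y)" for y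
        unfolding S_def lin(3)[OF tk] simplex_difference(1)[OF R ij pk] by (rule scaleR_minus_right)
      \<comment> \<open>\<open>S\<close> and \<open>T\<close> contribute a sign each, and the two
        signs cancel.\<close>
      then have "orth_proj (U (Transposition.transpose i j (p k))) (S (T y)) = S (T (orth_proj (U (p k)) y))" for y
        using linS linT TR[OF pk, of y]
        by (simp add: P[OF pk] P[OF tk] linear_add linear_diff linear_scale linear_neg algebra_simps)
      then show ?thesis
        using V(2)[OF k] by simp
    qed
    moreover have "Transposition.transpose i j \<circ> p permutes {1..n}"
      using ij swap.hyps(4) by (intro permutes_compose permutes_swap_id)
    ultimately show ?case
      unfolding is_symmetry_def using orth conj_orthogonal_iff[OF orth] by blast
  qed
  then show ?thesis
    using eitff unfolding totally_symmetric_def by blast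
qed

text \<open>The frame identity determines both \<open>a\<close> and \<sigma>. As \<sigma> is below
  \<open>1\<close>, any two of the subspaces meet in \<open>0\<close>, so by dimension they span the
  whole space. The anticommutator of two projections can then be computed on each of the two
  summands.\<close>

lemma simplex_involutions_of_eitff:
  fixes U :: "nat \<Rightarrow> 'e::euclidean_space set"
  assumes E: "EITFF (2 * r) r n U" and r: "r > 0"
  shows "simplex_involutions n (\<lambda>i x. 2 *\<^sub>R orth_proj (U i) x - x)"
proof -
  define p where "p i = orth_proj (U i)" for i
  have dim: "DIM('e) = 2 * r" and n: "n \<ge> 2"
    and U: "\<And>i. i \<in> {1..n} \<Longrightarrow> subspace (U i)" "\<And>i. i \<in> {1..n} \<Longrightarrow> dim (U i) = r"
    using E by (auto simp: EITFF_def)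
  obtain \<sigma> where iso: "\<And>i j x. i \<in> {1..n} \<Longrightarrow> j \<in> {1..n} \<Longrightarrow> i \<noteq> j \<Longrightarrow>
      p i (p j (p i x)) = \<sigma>\<^sup>2 *\<^sub>R p i x"
    using E unfolding EITFF_def equi_isoclinic_def p_def by blast
  obtain a where tff: "\<And>x. (\<Sum>i=1..n. p i x) = a *\<^sub>R x"
    using E unfolding EITFF_def tight_fusion_frame_def p_def by blast
  have lin: "linear (p i)" if "i \<in> {1..n}" for i
    unfolding p_def using U(1)[OF that] by (rule linear_orth_proj)
  have sym: "p i x \<bullet> y = x \<bullet> p i y" if "i \<in> {1..n}" for i x y
    unfolding p_def using U(1)[OF that] by (rule orth_proj_self_adjoint)
  have pU: "p i x = x" if "i \<in> {1..n}" "x \<in> U i" for i x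
    unfolding p_def using U(1)[OF that(1)] that(2) by (rule orth_proj_mem)
  have Up: "p i x \<in> U i" if "i \<in> {1..n}" for i x
    unfolding p_def using U(1)[OF that(1)] by (rule orth_proj(1))
  have idem: "p i (p i x) = p i x" if "i \<in> {1..n}" for i x
    using that Up pU by blast
  \<comment> \<open>Both sides of the frame identity are compared by trace:
    \<open>2 r a = n r\<close>.\<close>
  have a: "a = real n / 2"
  proof -
    have "a * DIM('e) = (\<Sum>b\<in>(Basis :: 'e set). b \<bullet> (\<Sum>i=1..n. p i b))"
      unfolding tff by simp
    also have "\<dots> = (\<Sum>i=1..n. \<Sum>b\<in>Basis. b \<bullet> p i b)"
      by (simp only: inner_sum_right) (rule sum.swap)
    also have "\<dots> = real n * r"
      using trace_orth_proj[OF U(1)] U(2) by (simp add: p_def)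
    finally show ?thesis
      using r dim by (simp add: field_simps)
  qed
  \<comment> \<open>The frame identity is evaluated at a nonzero vector of \<open>U 1\<close> and
    projected back to \<open>U 1\<close>, where every other index contributes the same
    multiple.\<close>
  have \<sigma>: "\<sigma>\<^sup>2 = (real n - 2) / (2 * (real n - 1))"
  proof -
    have 1: "1 \<in> {1..n}" using n by simp
    have "\<not> U 1 \<subseteq> {0}"
      using U(2)[OF 1] r by (metis dim_eq_0 less_numeral_extra(3))
    then obtain x where x: "x \<in> U 1" "x \<noteq> 0" by auto
    have "a *\<^sub>R x = p 1 (\<Sum>i=1..n. p i x)"
      using x pU[OF 1] by (simp only: tff linear_scale[OF lin[OF 1]])
    also have "\<dots> = (\<Sum>i=1..n. p 1 (p i x))"
      by (rule linear_sum[OF lin[OF 1]])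
    also have "\<dots> = (\<Sum>i=1..n. (if i = 1 then 1 else \<sigma>\<^sup>2) *\<^sub>R x)"
    proof (rule sum.cong[OF refl])
      fix i assume i: "i \<in> {1..n}"
      show "p 1 (p i x) = (if i = 1 then 1 else \<sigma>\<^sup>2) *\<^sub>R x"
        using iso[OF 1 i, of x] pU[OF 1 x(1)] by auto
    qed
    also have "\<dots> = (1 + (real n - 1) * \<sigma>\<^sup>2) *\<^sub>R x"
    proof -
      have "{1..n} = insert 1 {2..n}" using n by auto
      then have "(\<Sum>i=1..n. (if i = 1 then 1 else \<sigma>\<^sup>2)) = 1 + (\<Sum>i=2..n. \<sigma>\<^sup>2)"
        by (simp cong: sum.cong_simp)
      then show ?thesis
        using n by (simp add: of_nat_diff flip: scaleR_left.sum)
    qed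
    finally have "real n / 2 = 1 + (real n - 1) * \<sigma>\<^sup>2"
      using x a by simp
    then show ?thesis
      using n by (simp add: field_simps)
  qed
  have \<sigma>1: "\<sigma>\<^sup>2 < 1"
    unfolding \<sigma> using n by (simp add: field_simps)
  \<comment> \<open>For \<open>y\<close> in \<open>U i\<close> both sides are
    \<open>\<sigma>\<^sup>2 *\<^sub>R y + p j y\<close>, and symmetrically for vectors of
    \<open>U j\<close>. As the two subspaces span everything, linearity gives the claim.\<close>
  have key: "p i (p j x) + p j (p i x) = p i x + p j x - (1 - \<sigma>\<^sup>2) *\<^sub>R x"
    if i: "i \<in> {1..n}" and j: "j \<in> {1..n}" and ij: "i \<noteq> j" for i j x
  proof -
    have "U i \<inter> U j = {0}"
    proof -
      have "x = 0" if "x \<in> U i" "x \<in> U j" for x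
      proof -
        have "x = \<sigma>\<^sup>2 *\<^sub>R x"
          using iso[OF i j ij, of x] pU i j that by simp
        then have "(1 - \<sigma>\<^sup>2) *\<^sub>R x = 0"
          by (simp add: scaleR_diff_left)
        with \<sigma>1 show ?thesis by simp
      qed
      then show ?thesis
        using subspace_0[OF U(1)[OF i]] subspace_0[OF U(1)[OF j]] by auto
    qed
    then have "dim {x + y |x y. x \<in> U i \<and> y \<in> U j} = DIM('e)"
      using dim_sums_Int[OF U(1)[OF i] U(1)[OF j]] U(2)[OF i] U(2)[OF j] dim by simp
    then have "span {x + y |x y. x \<in> U i \<and> y \<in> U j} = UNIV"
      by (simp add: dim_eq_full)
    then have "{x + y |x y. x \<in> U i \<and> y \<in> U j} = UNIV"
      by (simp only: span_eq_iff[THEN iffD2, OF subspace_sums[OF U(1)[OF i] U(1)[OF j]]])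
    then obtain y z where yz: "x = y + z" "y \<in> U i" "z \<in> U j" by blast
    have "p i (p j y) = \<sigma>\<^sup>2 *\<^sub>R y" "p j (p i z) = \<sigma>\<^sup>2 *\<^sub>R z"
      using iso[OF i j ij, of y] iso[OF j i, of z] ij pU yz i j by simp_all
    then show ?thesis
      using lin[OF i] lin[OF j] pU[OF i yz(2)] pU[OF j yz(3)]
      by (simp add: yz(1) linear_add algebra_simps)
  qed
  show ?thesis
    unfolding simplex_involutions_def p_def[symmetric]
  proof (intro conjI ballI allI impI)
    fix i assume i: "i \<in> {1..n}"
    note l = lin[OF i]
    show "linear (\<lambda>x. 2 *\<^sub>R p i x - x)"
      by (rule linear_compose_sub[OF linear_compose_scale_right[OF l] linear_ident])
    show "2 *\<^sub>R p i (2 *\<^sub>R p i x - x) - (2 *\<^sub>R p i x - x) = x" for x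
      using l by (simp add: linear_diff linear_scale linear_add idem[OF i] scaleR_2)
    show "(2 *\<^sub>R p i x - x) \<bullet> y = x \<bullet> (2 *\<^sub>R p i y - y)" for x y
      by (simp add: inner_diff_left inner_diff_right sym[OF i])
    fix j x assume j: "j \<in> {1..n}" and ij: "i \<noteq> j"
    have "2 *\<^sub>R p i (2 *\<^sub>R p j x - x) - (2 *\<^sub>R p j x - x) +
      (2 *\<^sub>R p j (2 *\<^sub>R p i x - x) - (2 *\<^sub>R p i x - x)) =
      4 *\<^sub>R (p i (p j x) + p j (p i x)) - 4 *\<^sub>R p i x - 4 *\<^sub>R p j x + 2 *\<^sub>R x"
      using l lin[OF j] by (simp add: linear_diff linear_scale algebra_simps flip: scaleR_2)
    also have "\<dots> = (4 * \<sigma>\<^sup>2 - 2) *\<^sub>R x"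
      unfolding key[OF i j ij] using scaleR_add_left[of 2 2 x] by (simp add: algebra_simps)
    also have "4 * \<sigma>\<^sup>2 - 2 = - 2 / (real n - 1)"
      unfolding \<sigma> using n by (simp add: field_simps)
    finally show "2 *\<^sub>R p i (2 *\<^sub>R p j x - x) - (2 *\<^sub>R p j x - x) +
      (2 *\<^sub>R p j (2 *\<^sub>R p i x - x) - (2 *\<^sub>R p i x - x)) = (- 2 / (real n - 1)) *\<^sub>R x" .
  next
    fix x
    have "(\<Sum>i=1..n. 2 *\<^sub>R p i x - x) = 2 *\<^sub>R (\<Sum>i=1..n. p i x) - real n *\<^sub>R x"
      by (simp add: sum_subtractf scaleR_sum_right sum_constant_scaleR del: sum_constant)
    then show "(\<Sum>i=1..n. 2 *\<^sub>R p i x - x) = 0"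
      unfolding tff a by simp
  qed
qed

text \<open>An orthonormal frame of the space spanned by the simplex: moving the first
  \<open>m\<close> vertices along the last one, all in the same way, makes them orthogonal.\<close>

lemma clifford_of_simplex_involutions:
  fixes R :: "nat \<Rightarrow> 'e::euclidean_space \<Rightarrow> 'e"
  assumes R: "simplex_involutions (m + 1) R" and m: "m \<ge> 1"
  obtains \<alpha> \<beta> where "clifford m (\<lambda>i x. \<alpha> *\<^sub>R R (i + 1) x + \<beta> *\<^sub>R R (m + 1) x)"
proof -
  \<comment> \<open>For \<beta> = \<alpha> t / m, orthogonality becomes the equation
    \<open>t\<^sup>2 = m + 2 * t\<close>, whose positive root is taken. Given orthogonality, unit
    length amounts to \<open>\<alpha>\<^sup>2 (1 + 1 / m) = 1\<close>.\<close>
  define \<alpha> where "\<alpha> = sqrt (real m / (real m + 1))"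
  define t where "t = 1 + sqrt (1 + real m)"
  define \<beta> where "\<beta> = \<alpha> * t / m"
  have \<alpha>: "\<alpha>\<^sup>2 = m / (real m + 1)"
    using m by (simp add: \<alpha>_def)
  have t: "t\<^sup>2 = m + 2 * t"
    by (simp add: t_def power2_sum)
  have orth: "\<alpha>\<^sup>2 * (- 2 / m) + 2 * (\<alpha> * \<beta>) * (- 2 / m) + 2 * \<beta>\<^sup>2 = 0"
  proof -
    have b: "\<beta>\<^sup>2 = \<alpha>\<^sup>2 * (m + 2 * t) / m\<^sup>2"
      by (simp add: \<beta>_def power_mult_distrib power_divide t)
    have ab: "\<alpha> * \<beta> = \<alpha>\<^sup>2 * t / m"
      by (simp add: \<beta>_def power2_eq_square)
    show ?thesis
      unfolding b ab using m by (simp add: field_simps power2_eq_square)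
  qed
  have unit: "\<alpha>\<^sup>2 + \<beta>\<^sup>2 + (\<alpha> * \<beta>) * (- 2 / m) = 1"
  proof -
    have "\<alpha>\<^sup>2 + \<beta>\<^sup>2 + (\<alpha> * \<beta>) * (- 2 / m) = \<alpha>\<^sup>2 + \<alpha>\<^sup>2 / m"
    proof -
      have "\<alpha>\<^sup>2 * (- 2 / m) = - 2 * (\<alpha>\<^sup>2 / m)"
        by simp
      moreover have "2 * (\<alpha> * \<beta>) * (- 2 / m) = 2 * ((\<alpha> * \<beta>) * (- 2 / m))"
        by (rule mult.assoc)
      ultimately show ?thesis
        using orth by linarith
    qed
    also have "\<dots> = 1"
      unfolding \<alpha> using m by (simp flip: add_divide_distrib)
    finally show ?thesis .
  qed
  define F where "F i x = \<alpha> *\<^sub>R R (i + 1) x + \<beta> *\<^sub>R R (m + 1) x" for i x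
  note D = simplex_involutionsD[OF R]
  have M: "m + 1 \<in> {1..m + 1}" by simp
  have I: "i + 1 \<in> {1..m + 1}" "i + 1 \<noteq> m + 1" if "i < m" for i using that by simp_all
  have lin: "R i (x + y) = R i x + R i y" "R i (c *\<^sub>R x) = c *\<^sub>R R i x" if "i \<in> {1..m + 1}" for i x y c
    using D(1)[OF that] by (simp_all add: linear_add linear_scale)
  have ac: "R i (R j x) + R j (R i x) = (- 2 / m) *\<^sub>R x"
    if "i \<in> {1..m + 1}" "j \<in> {1..m + 1}" "i \<noteq> j" for i j x
    using D(4)[OF that] by simp
  have "clifford m F"
    unfolding clifford_def
  proof (intro conjI allI impI)
    fix i assume i: "i < m"
    note i' = I[OF i]
    show "linear (F i)"
      unfolding F_def using D(1)[OF i'(1)] D(1)[OF M]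
      by (intro linear_compose_add linear_compose_scale_right)
    show "F i x \<bullet> y = x \<bullet> F i y" for x y
      by (simp only: F_def inner_add_left inner_add_right inner_scaleR_left inner_scaleR_right
          D(3)[OF i'(1)] D(3)[OF M])
    show "F i (F i x) = x" for x
    proof -
      have "F i (F i x) = (\<alpha>\<^sup>2 + \<beta>\<^sup>2) *\<^sub>R x +
          (\<alpha> * \<beta>) *\<^sub>R (R (i + 1) (R (m + 1) x) + R (m + 1) (R (i + 1) x))"
        unfolding F_def lin[OF i'(1)] lin[OF M] D(2)[OF i'(1)] D(2)[OF M]
        by (simp add: algebra_simps power2_eq_square)
      also have "\<dots> = (\<alpha>\<^sup>2 + \<beta>\<^sup>2 + (\<alpha> * \<beta>) * (- 2 / m)) *\<^sub>R x"
        unfolding ac[OF i'(1) M i'(2)] by (simp only: scaleR_add_left scaleR_scaleR)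
      finally show ?thesis
        by (simp only: unit scaleR_one)
    qed
    fix j x assume j: "j < m" and ij: "i \<noteq> j"
    note j' = I[OF j]
    have ij': "i + 1 \<noteq> j + 1" using ij by simp
    have "F i (F j x) + F j (F i x) =
       \<alpha>\<^sup>2 *\<^sub>R (R (i + 1) (R (j + 1) x) + R (j + 1) (R (i + 1) x)) +
       (\<alpha> * \<beta>) *\<^sub>R ((R (i + 1) (R (m + 1) x) + R (m + 1) (R (i + 1) x)) +
         (R (j + 1) (R (m + 1) x) + R (m + 1) (R (j + 1) x))) + (2 * \<beta>\<^sup>2) *\<^sub>R x"
      unfolding F_def lin[OF i'(1)] lin[OF j'(1)] lin[OF M] D(2)[OF M]
      by (simp add: algebra_simps power2_eq_square flip: scaleR_2)
    also have "\<dots> = (\<alpha>\<^sup>2 * (- 2 / m) + 2 * (\<alpha> * \<beta>) * (- 2 / m) + 2 * \<beta>\<^sup>2) *\<^sub>R x"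
      unfolding ac[OF i'(1) M i'(2)] ac[OF j'(1) M j'(2)] ac[OF i'(1) j'(1) ij']
      by (simp add: algebra_simps flip: scaleR_2)
    finally show "F i (F j x) = - F j (F i x)"
      by (simp only: orth scaleR_zero_left) (simp only: eq_neg_iff_add_eq_0)
  qed
  then show ?thesis
    using that unfolding F_def by blast
qed

text \<open>A symmetry \<open>V\<close> induces the transposition of \<open>1\<close> and
  \<open>2\<close> on the reflections, and \<open>R 1 - R 2\<close> undoes it at the price of a
  sign. The composite \<open>T\<close> anticommutes with every reflection, hence with the
  \<open>8 * B + 1\<close> generators built from them, and \<open>clifford_twist_dvd\<close>
  applies.\<close>

lemma totally_symmetric_eitff_dvd:
  fixes U :: "nat \<Rightarrow> 'e::euclidean_space set"
  assumes E: "EITFF (2 * r) r (8 * B + 2) U" and sym: "totally_symmetric (8 * B + 2) U"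
    and r: "r > 0"
  shows "16 ^ B dvd r"
proof -
  define R where "R i x = 2 *\<^sub>R orth_proj (U i) x - x" for i x
  let ?n = "8 * B + 1 + 1"
  have R: "simplex_involutions ?n R"
    using simplex_involutions_of_eitff[OF E r] unfolding R_def by (simp add: eval_nat_numeral)
  obtain \<alpha> \<beta> where C: "clifford (8 * B + 1) (\<lambda>i x. \<alpha> *\<^sub>R R (i + 1) x + \<beta> *\<^sub>R R (8 * B + 1 + 1) x)"
    using clifford_of_simplex_involutions[OF R] by auto
  note D = simplex_involutionsD[OF R]
  let ?s = "Transposition.transpose 1 2 :: nat \<Rightarrow> nat"
  have 12: "1 \<in> {1..?n}" "2 \<in> {1..?n}" "(1::nat) \<noteq> 2" by auto
  then have s: "?s permutes {1..8 * B + 2}"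
    by (intro permutes_swap_id) auto
  obtain V where V: "orthogonal_transformation V"
      "\<And>k x. k \<in> {1..?n} \<Longrightarrow> orth_proj (U (?s k)) (V x) = V (orth_proj (U k) x)"
    using sym s conj_orthogonal_iff unfolding totally_symmetric_def is_symmetry_def by fastforce
  have linV: "linear V"
    using V(1) by (simp add: orthogonal_transformation_def)
  have VR: "R (?s k) (V x) = V (R k x)" if "k \<in> {1..?n}" for k x
    using V(2)[OF that] by (simp add: R_def linear_diff[OF linV] linear_scale[OF linV])
  define S where "S x = R 1 x - R 2 x" for x
  have linS: "linear S"
    unfolding S_def using D(1)[OF 12(1)] D(1)[OF 12(2)] by (intro linear_compose_sub)
  have ss: "?s (?s k) = k" for k by simp
  have sk: "?s k \<in> {1..?n}" if "k \<in> {1..?n}" for k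
    using that 12 by (auto simp: Transposition.transpose_def)
  have SR: "S (R (?s k) x) = - R k (S x)" if "k \<in> {1..?n}" for k x
    using simplex_difference(1)[OF R 12 sk[OF that], of x] by (simp add: S_def)
  have SS: "S (S x) = (2 + 2 / (real ?n - 1)) *\<^sub>R x" for x
    using simplex_difference(2)[OF R 12, of x] by (simp add: S_def)
  define T where "T = S \<circ> V"
  have TR: "T (R k x) = - R k (T x)" if "k \<in> {1..?n}" for k x
    using SR[OF that, of "V x"] VR[OF that, of x] by (simp add: T_def)
  have linT: "linear T"
    unfolding T_def using linV linS by (rule linear_compose)
  have "2 + 2 / (real ?n - 1) > 0"
    by (simp add: add_pos_pos)
  then have "inj S"
    using SS by (metis (no_types, lifting) injI less_irrefl scaleR_cancel_left)
  then have injT: "inj T"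
    unfolding T_def using orthogonal_transformation_inj[OF V(1)] by (rule inj_compose)
  have "2 * 16 ^ B dvd DIM('e)"
  proof (rule clifford_twist_dvd[OF C linT injT])
    fix i x assume i: "i < 8 * B + 1"
    then have "T (R (i + 1) x) = - R (i + 1) (T x)"
      by (intro TR) auto
    moreover have "T (R (8 * B + 1 + 1) x) = - R (8 * B + 1 + 1) (T x)"
      by (rule TR) auto
    ultimately show "T (\<alpha> *\<^sub>R R (i + 1) x + \<beta> *\<^sub>R R (8 * B + 1 + 1) x) =
      - (\<alpha> *\<^sub>R R (i + 1) (T x) + \<beta> *\<^sub>R R (8 * B + 1 + 1) (T x))"
      by (simp add: linear_add[OF linT] linear_scale[OF linT])
  qed
  then show ?thesis
    using E by (simp add: EITFF_def)
qed

section \<open>Signed permutations\<close>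

text \<open>\<open>\<pi> i\<close> and \<open>s i\<close> encode the signed permutation operator mapping \<open>f\<close> to
  \<open>k \<mapsto> s i k * f (\<pi> i k)\<close>. The operators anticommute pairwise; those with index below \<open>p\<close>
  are symmetric with square \<open>1\<close>, the others are skew with square \<open>-1\<close>.\<close>

definition signed_family ::
  "'i set \<Rightarrow> nat \<Rightarrow> nat \<Rightarrow> (nat \<Rightarrow> 'i \<Rightarrow> 'i) \<Rightarrow> (nat \<Rightarrow> 'i \<Rightarrow> real) \<Rightarrow> bool" where
  "signed_family I p m \<pi> s \<longleftrightarrow>
     (\<forall>i<m. \<forall>k\<in>I. \<pi> i k \<in> I \<and> \<pi> i (\<pi> i k) = k \<and> s i k * s i k = 1 \<and>
        s i (\<pi> i k) = (if i < p then s i k else - s i k)) \<and>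
     (\<forall>i<m. \<forall>j<m. i \<noteq> j \<longrightarrow> (\<forall>k\<in>I. \<pi> i (\<pi> j k) = \<pi> j (\<pi> i k) \<and>
        s i k * s j (\<pi> i k) = - (s j k * s i (\<pi> j k))))"

lemma signed_familyD:
  assumes "signed_family I p m \<pi> s" "i < m" "k \<in> I"
  shows "\<pi> i k \<in> I" "\<pi> i (\<pi> i k) = k" "s i k * s i k = 1"
    "s i (\<pi> i k) = (if i < p then s i k else - s i k)"
    "j < m \<Longrightarrow> i \<noteq> j \<Longrightarrow> \<pi> i (\<pi> j k) = \<pi> j (\<pi> i k)"
    "j < m \<Longrightarrow> i \<noteq> j \<Longrightarrow> s i k * s j (\<pi> i k) = - (s j k * s i (\<pi> j k))"
  using assms unfolding signed_family_def by blast+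

definition has_signed_family :: "nat \<Rightarrow> nat \<Rightarrow> nat \<Rightarrow> bool" where
  "has_signed_family N p m \<longleftrightarrow> (\<exists>\<pi> s. signed_family {..<N} p m \<pi> s)"

text \<open>Relabelling along \<open>f\<close> makes only the size of the index set matter, so
  families built on bit strings can act on the coordinates of any space of that dimension.\<close>

lemma signed_family_transfer:
  assumes F: "signed_family I p m \<pi> s" and f: "bij_betw f I J"
  shows "\<exists>\<pi> s. signed_family J p m \<pi> s"
proof -
  define g where "g = the_inv_into I f"
  have inj: "inj_on f I" and J: "f ` I = J"
    using f by (auto simp: bij_betw_def)
  have gf: "g (f k) = k" if "k \<in> I" for k
    using that inj by (simp add: g_def the_inv_into_f_f)
  have "signed_family J p m (\<lambda>i k. f (\<pi> i (g k))) (\<lambda>i k. s i (g k))"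
    unfolding signed_family_def J[symmetric] ball_simps
  proof (intro conjI allI impI ballI)
    fix i k assume "i < m" "k \<in> I"
    note D = signed_familyD[OF F this]
    show "f (\<pi> i (g (f k))) \<in> f ` I" "f (\<pi> i (g (f (\<pi> i (g (f k)))))) = f k"
      "s i (g (f k)) * s i (g (f k)) = 1"
      "s i (g (f (\<pi> i (g (f k))))) = (if i < p then s i (g (f k)) else - s i (g (f k)))"
      using D(1-4) \<open>k \<in> I\<close> by (simp_all add: gf)
    fix j assume j: "j < m" "i \<noteq> j"
    note D' = signed_familyD[OF F j(1) \<open>k \<in> I\<close>]
    show "f (\<pi> i (g (f (\<pi> j (g (f k)))))) = f (\<pi> j (g (f (\<pi> i (g (f k))))))"
      using D(1) D'(1) D(5)[OF j] \<open>k \<in> I\<close> by (simp add: gf)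
    show "s i (g (f k)) * s j (g (f (\<pi> i (g (f k))))) =
        - (s j (g (f k)) * s i (g (f (\<pi> j (g (f k))))))"
      using D(1) D'(1) D(6)[OF j] \<open>k \<in> I\<close> by (simp add: gf)
  qed
  then show ?thesis by blast
qed

lemma signed_family_of_card:
  assumes "has_signed_family N p m" "finite J" "card J = N"
  shows "\<exists>\<pi> s. signed_family J p m \<pi> s"
proof -
  obtain f where "bij_betw f {..<N} J"
    using assms(2,3) ex_bij_betw_nat_finite by (metis atLeast0LessThan)
  then show ?thesis
    using assms(1) signed_family_transfer unfolding has_signed_family_def by blast
qed

lemma has_signed_familyI:
  assumes "signed_family I p m \<pi> s" "finite I" "card I = N"
  shows "has_signed_family N p m"
proof -
  obtain f where "bij_betw f I {..<N}"
    using assms(2,3) ex_bij_betw_finite_nat by (metis atLeast0LessThan)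
  then show ?thesis
    using assms(1) signed_family_transfer unfolding has_signed_family_def by blast
qed

text \<open>The tensor product with an identity matrix of order \<open>a\<close>.\<close>

lemma has_signed_family_mult:
  assumes "has_signed_family N p m"
  shows "has_signed_family (N * a) p m"
proof -
  obtain \<pi> s where F: "signed_family {..<N} p m \<pi> s"
    using assms unfolding has_signed_family_def by blast
  show ?thesis
  proof (rule has_signed_familyI)
    show "signed_family ({..<N} \<times> {..<a}) p m (\<lambda>i (k, l). (\<pi> i k, l)) (\<lambda>i (k, l). s i k)"
      unfolding signed_family_def
    proof (intro conjI allI impI ballI)
      fix i x assume i: "i < m" and x: "x \<in> {..<N} \<times> {..<a}"
      obtain k l where kl: "x = (k, l)" "k \<in> {..<N}" "l \<in> {..<a}"
        using x by auto
      note D = signed_familyD[OF F i kl(2)]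
      show "(case x of (k, l) \<Rightarrow> (\<pi> i k, l)) \<in> {..<N} \<times> {..<a}"
        "(case case x of (k, l) \<Rightarrow> (\<pi> i k, l) of (k, l) \<Rightarrow> (\<pi> i k, l)) = x"
        "(case x of (k, l) \<Rightarrow> s i k) * (case x of (k, l) \<Rightarrow> s i k) = 1"
        "(case case x of (k, l) \<Rightarrow> (\<pi> i k, l) of (k, l) \<Rightarrow> s i k) =
          (if i < p then case x of (k, l) \<Rightarrow> s i k else - (case x of (k, l) \<Rightarrow> s i k))"
        using D(1-4) kl by simp_all
      fix j assume j: "j < m" "i \<noteq> j"
      show "(case case x of (k, l) \<Rightarrow> (\<pi> j k, l) of (k, l) \<Rightarrow> (\<pi> i k, l)) =
          (case case x of (k, l) \<Rightarrow> (\<pi> i k, l) of (k, l) \<Rightarrow> (\<pi> j k, l))"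
        using D(5)[OF j] kl by simp
      show "(case x of (k, l) \<Rightarrow> s i k) * (case case x of (k, l) \<Rightarrow> (\<pi> i k, l) of (k, l) \<Rightarrow> s j k) =
          - ((case x of (k, l) \<Rightarrow> s j k) * (case case x of (k, l) \<Rightarrow> (\<pi> j k, l) of (k, l) \<Rightarrow> s i k))"
        using D(6)[OF j] kl by simp
    qed
  qed auto
qed

section \<open>Explicit families in orders 8 and 16 and their periodic extension\<close>

abbreviation sgn_bit :: "bool \<Rightarrow> real" where
  "sgn_bit b \<equiv> if b then - 1 else 1"

text \<open>The tables \<open>flip7\<close> and \<open>sign7\<close> list the seven words \<open>1\<epsilon>x, 1\<epsilon>z, x1\<epsilon>, z1\<epsilon>, \<epsilon>x1, \<epsilon>z1, \<epsilon>\<epsilon>\<epsilon>\<close> in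
  tensor products of the \<open>2 \<times> 2\<close> matrices \<open>x = (0 1; 1 0)\<close>, \<open>z = (1 0; 0 -1)\<close>, \<open>\<epsilon> = zx\<close>: the letters
  \<open>x, \<epsilon>\<close> flip a bit and \<open>z, \<epsilon>\<close> contribute the sign of a bit.\<close>

definition flip7 :: "nat \<Rightarrow> bool \<times> bool \<times> bool \<Rightarrow> bool \<times> bool \<times> bool" where
  "flip7 i = (\<lambda>(a, b, c). (a \<noteq> (i \<in> {2, 4, 5, 6}), b \<noteq> (i \<in> {0, 1, 4, 6}), c \<noteq> (i \<in> {0, 2, 3, 6})))"

definition sign7 :: "nat \<Rightarrow> bool \<times> bool \<times> bool \<Rightarrow> real" where
  "sign7 i = (\<lambda>(a, b, c). sgn_bit (a \<and> i \<in> {3, 4, 5, 6}) * sgn_bit (b \<and> i \<in> {0, 1, 5, 6}) *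
     sgn_bit (c \<and> i \<in> {1, 2, 3, 6}))"

lemma less_7_cases: "(i::nat) < 7 \<longleftrightarrow> i = 0 \<or> i = 1 \<or> i = 2 \<or> i = 3 \<or> i = 4 \<or> i = 5 \<or> i = 6"
  by auto

text \<open>Together with the identity these seven skew matrices realise the Radon-Hurwitz number
  \<open>8\<close> in order \<open>8\<close>. The relations are checked case by case.\<close>

lemma signed_family_7: "signed_family UNIV 0 7 flip7 sign7"
proof -
  have a: "\<forall>i<7. \<forall>k. flip7 i (flip7 i k) = k \<and> sign7 i k * sign7 i k = 1 \<and>
      sign7 i (flip7 i k) = (if i < 0 then sign7 i k else - sign7 i k)"
    unfolding less_7_cases by (auto simp: flip7_def sign7_def)
  have b: "\<forall>i<7. \<forall>j<7. i \<noteq> j \<longrightarrow> (\<forall>k. flip7 i (flip7 j k) = flip7 j (flip7 i k))"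
    unfolding flip7_def by auto
  have c: "\<forall>i<7. \<forall>j<7. i \<noteq> j \<longrightarrow> (\<forall>k. sign7 i k * sign7 j (flip7 i k) = - (sign7 j k * sign7 i (flip7 j k)))"
    unfolding less_7_cases flip7_def sign7_def
    by (intro allI impI; elim disjE; simp split: prod.split)
  show ?thesis
    unfolding signed_family_def using a b c by blast
qed

text \<open>The words \<open>F\<^sub>i \<otimes> x\<close> for the seven words \<open>F\<^sub>i\<close> above, and \<open>1 \<otimes> \<epsilon>\<close>. All eight anticommute with
  \<open>1 \<otimes> z\<close>, by which any other family can be tensored to extend it by these eight.\<close>

definition flip8 :: "nat \<Rightarrow> (bool \<times> bool \<times> bool) \<times> bool \<Rightarrow> (bool \<times> bool \<times> bool) \<times> bool" where
  "flip8 i = (\<lambda>(w, d). (if i < 7 then flip7 i w else w, \<not> d))"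

definition sign8 :: "nat \<Rightarrow> (bool \<times> bool \<times> bool) \<times> bool \<Rightarrow> real" where
  "sign8 i = (\<lambda>(w, d). if i < 7 then sign7 i w else sgn_bit d)"

lemma signed_family_8: "signed_family UNIV 0 8 flip8 sign8"
  unfolding signed_family_def
proof (intro conjI allI impI ballI)
  note D = signed_familyD[OF signed_family_7 _ UNIV_I]
  fix i :: nat and k :: "(bool \<times> bool \<times> bool) \<times> bool" assume i: "i < 8"
  obtain w d where k: "k = (w, d)" by fastforce
  show "flip8 i k \<in> UNIV" by simp
  show "flip8 i (flip8 i k) = k" "sign8 i k * sign8 i k = 1"
    "sign8 i (flip8 i k) = (if i < 0 then sign8 i k else - sign8 i k)"
    using D(2-4)[of i w] by (auto simp: flip8_def sign8_def k)
  fix j :: nat assume j: "j < 8" "i \<noteq> j"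
  consider "i < 7" "j < 7" | "i < 7" "j = 7" | "i = 7" "j < 7"
    using i j by linarith
  note c = this
  show "flip8 i (flip8 j k) = flip8 j (flip8 i k)"
    using D(5)[of i j w] j by (auto simp: flip8_def k)
  show "sign8 i k * sign8 j (flip8 i k) = - (sign8 j k * sign8 i (flip8 j k))"
    using c
  proof cases
    case 1
    then show ?thesis
      using D(6)[of i j w] j by (simp add: flip8_def sign8_def k)
  qed (use D(4)[of i w] D(4)[of j w] in \<open>simp_all add: flip8_def sign8_def k\<close>)
qed

lemma has_signed_family_step:
  assumes "has_signed_family N p m" and p: "p \<le> m"
  shows "has_signed_family (16 * N) p (m + 8)"
proof -
  obtain \<pi> s where F: "signed_family {..<N} p m \<pi> s"
    using assms unfolding has_signed_family_def by blast
  define \<pi>' where "\<pi>' i = (\<lambda>(k, w). if i < m then (\<pi> i k, w) else (k, flip8 (i - m) w))" for i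
  define s' where "s' i = (\<lambda>(k, w). if i < m then s i k * sgn_bit (snd w) else sign8 (i - m) w)" for i
  have G: "snd (flip8 i w) = (\<not> snd w)" for i w
    by (simp add: flip8_def split: prod.split)
  note D = signed_familyD[OF F] and D8 = signed_familyD[OF signed_family_8 _ UNIV_I]
  have "signed_family ({..<N} \<times> UNIV) p (m + 8) \<pi>' s'"
    unfolding signed_family_def
  proof (intro conjI allI impI ballI)
    fix i x assume i: "i < m + 8" and x: "x \<in> {..<N} \<times> (UNIV :: ((bool \<times> bool \<times> bool) \<times> bool) set)"
    obtain k w where kw: "x = (k, w)" "k \<in> {..<N}"
      using x by auto
    have i8: "\<not> i < m \<Longrightarrow> i - m < 8" using i by auto
    show "\<pi>' i x \<in> {..<N} \<times> UNIV" "\<pi>' i (\<pi>' i x) = x" "s' i x * s' i x = 1"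
      "s' i (\<pi>' i x) = (if i < p then s' i x else - s' i x)"
      using D(1-4)[OF _ kw(2), of i] D8(2-4)[OF i8, of w] p kw(2)
      by (auto simp: \<pi>'_def s'_def kw(1))
    fix j assume j: "j < m + 8" "i \<noteq> j"
    have j8: "\<not> j < m \<Longrightarrow> j - m < 8" using j by auto
    have ne: "\<not> i < m \<Longrightarrow> \<not> j < m \<Longrightarrow> i - m \<noteq> j - m" using j(2) by auto
    show "\<pi>' i (\<pi>' j x) = \<pi>' j (\<pi>' i x)"
      using D(5)[OF _ kw(2) _ j(2)] D8(5)[OF i8 j8 ne, of w]
      by (auto simp: \<pi>'_def kw(1))
    consider "i < m" "j < m" | "i < m" "\<not> j < m" | "\<not> i < m" "j < m" | "\<not> i < m" "\<not> j < m"
      by blast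
    then show "s' i x * s' j (\<pi>' i x) = - (s' j x * s' i (\<pi>' j x))"
    proof cases
      case 1
      then show ?thesis
        using D(6)[OF 1(1) kw(2) 1(2) j(2)] by (simp add: \<pi>'_def s'_def kw(1))
    next
      case 4
      then show ?thesis
        using D8(6)[OF i8 j8 ne, of w] by (simp add: \<pi>'_def s'_def kw(1))
    qed (simp_all add: \<pi>'_def s'_def kw(1) G)
  qed
  then show ?thesis
    by (rule has_signed_familyI) (simp_all add: card_cartesian_product card_UNIV_bool flip: UNIV_Times_UNIV)
qed

text \<open>The periodicity of real Clifford modules, eight generators against a factor of
  \<open>16\<close>; it is the constructive counterpart of
  \<open>clifford_reduction\<close>.\<close>

lemma has_signed_family_period:
  assumes "has_signed_family N p m" "p \<le> m"
  shows "has_signed_family (16 ^ b * N) p (m + 8 * b)"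
proof (induction b)
  case (Suc b)
  then show ?case
    using has_signed_family_step[OF Suc] assms(2) by (simp add: algebra_simps)
qed (use assms in simp)

text \<open>One family of order \<open>2 ^ c\<close> for each \<open>c\<close> up to
  \<open>3\<close>. In orders \<open>1\<close> and \<open>2\<close> a symmetric operator is listed
  first, which later gives rise to \<open>T\<close>; in orders \<open>4\<close> and \<open>8\<close>
  all operators are skew.\<close>

lemma has_signed_family_base:
  "has_signed_family 1 1 1" "has_signed_family 2 1 2" "has_signed_family 4 0 3" "has_signed_family 8 0 7"
proof -
  have "signed_family {..<1} 1 1 (\<lambda>_ k. k) (\<lambda>_ _. 1)"
    by (simp add: signed_family_def)
  then show "has_signed_family 1 1 1"
    unfolding has_signed_family_def by blast
  have "signed_family UNIV 1 2 (\<lambda>i k. if i = 0 then k else \<not> k) (\<lambda>i. sgn_bit)"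
    by (auto simp: signed_family_def)
  then show "has_signed_family 2 1 2"
    by (rule has_signed_familyI) auto
  have "signed_family UNIV 0 3 (\<lambda>i (a, b). (a \<noteq> (i \<in> {0, 2}), b \<noteq> (i \<in> {0, 1})))
     (\<lambda>i (a, b). sgn_bit (a \<and> i \<in> {1, 2}) * sgn_bit (b \<and> i \<in> {0, 1}))"
    by (auto simp: signed_family_def numeral_3_eq_3 less_Suc_eq split: if_splits)
  then show "has_signed_family 4 0 3"
    by (rule has_signed_familyI) (simp_all flip: UNIV_Times_UNIV)
  show "has_signed_family 8 0 7"
    by (rule has_signed_familyI[OF signed_family_7]) (simp_all flip: UNIV_Times_UNIV)
qed

section \<open>Signed permutations as operators, and the frames they generate\<close>

definition signed_op :: "('e \<Rightarrow> 'e) \<Rightarrow> ('e \<Rightarrow> real) \<Rightarrow> 'e::euclidean_space \<Rightarrow> 'e" where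
  "signed_op \<pi> s x = (\<Sum>k\<in>Basis. (s k * (x \<bullet> \<pi> k)) *\<^sub>R k)"

lemma signed_op_inner_Basis: "k \<in> Basis \<Longrightarrow> signed_op \<pi> s x \<bullet> k = s k * (x \<bullet> \<pi> k)"
  by (simp add: signed_op_def inner_sum_left_Basis)

lemma linear_signed_op: "linear (signed_op \<pi> s)"
  by (rule linearI)
    (simp_all add: signed_op_def inner_add_left scaleR_sum_right algebra_simps flip: sum.distrib)

text \<open>As \<open>\<pi> i\<close> is an involution, reindexing by it shows that the adjoint has
  the signs \<open>s i (\<pi> i k)\<close>. The sign rule thus says symmetric below \<open>p\<close>
  and skew from there on.\<close>

lemma signed_family_ops:
  fixes \<pi> :: "nat \<Rightarrow> 'e::euclidean_space \<Rightarrow> 'e"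
  assumes F: "signed_family Basis p m \<pi> s" and i: "i < m"
  shows "signed_op (\<pi> i) (s i) (signed_op (\<pi> i) (s i) x) = (if i < p then x else - x)"
    and "signed_op (\<pi> i) (s i) x \<bullet> y = (if i < p then x \<bullet> signed_op (\<pi> i) (s i) y else - (x \<bullet> signed_op (\<pi> i) (s i) y))"
    and "j < m \<Longrightarrow> i \<noteq> j \<Longrightarrow> signed_op (\<pi> i) (s i) (signed_op (\<pi> j) (s j) x) =
      - signed_op (\<pi> j) (s j) (signed_op (\<pi> i) (s i) x)"
proof -
  note D = signed_familyD[OF F i]
  have sq: "s i k * (s i k * z) = z" if "k \<in> Basis" for k z
    using D(3)[OF that] by (simp flip: mult.assoc)
  show "signed_op (\<pi> i) (s i) (signed_op (\<pi> i) (s i) x) = (if i < p then x else - x)"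
    by (rule euclidean_eqI) (auto simp: signed_op_inner_Basis D(1,2,4) sq)
  let ?e = "if i < p then 1 else - 1 :: real"
  have "signed_op (\<pi> i) (s i) x \<bullet> y = (\<Sum>k\<in>Basis. s i k * (x \<bullet> \<pi> i k) * (y \<bullet> k))"
    by (subst euclidean_inner) (simp add: signed_op_inner_Basis)
  also have "\<dots> = (\<Sum>k\<in>Basis. s i (\<pi> i k) * (x \<bullet> k) * (y \<bullet> \<pi> i k))"
    by (rule sum.reindex_bij_witness[where i = "\<pi> i" and j = "\<pi> i"]) (auto simp: D(1,2))
  also have "\<dots> = (\<Sum>k\<in>Basis. ?e * ((x \<bullet> k) * (s i k * (y \<bullet> \<pi> i k))))"
    by (rule sum.cong) (auto simp: D(4))
  also have "\<dots> = ?e * (x \<bullet> signed_op (\<pi> i) (s i) y)"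
    by (subst (3) euclidean_inner) (simp add: signed_op_inner_Basis sum_distrib_left)
  finally show "signed_op (\<pi> i) (s i) x \<bullet> y =
      (if i < p then x \<bullet> signed_op (\<pi> i) (s i) y else - (x \<bullet> signed_op (\<pi> i) (s i) y))"
    by auto
  assume j: "j < m" "i \<noteq> j"
  show "signed_op (\<pi> i) (s i) (signed_op (\<pi> j) (s j) x) =
      - signed_op (\<pi> j) (s j) (signed_op (\<pi> i) (s i) x)"
  proof (rule euclidean_eqI)
    fix k :: 'e assume k: "k \<in> Basis"
    have "s i k * s j (\<pi> i k) * (x \<bullet> \<pi> j (\<pi> i k)) = - (s j k * s i (\<pi> j k)) * (x \<bullet> \<pi> i (\<pi> j k))"
      using D(5,6)[OF k j] by simp
    then show "signed_op (\<pi> i) (s i) (signed_op (\<pi> j) (s j) x) \<bullet> k =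
      - signed_op (\<pi> j) (s j) (signed_op (\<pi> i) (s i) x) \<bullet> k"
      using k D(1)[OF k] signed_familyD(1)[OF F j(1) k] by (simp add: signed_op_inner_Basis)
  qed
qed

text \<open>\<open>A\<close> symmetric and \<open>F\<^sub>i\<close> skew yield the symmetric \<open>F\<^sub>i \<otimes> \<epsilon>, 1 \<otimes> x, 1 \<otimes> z\<close> and the skew
  \<open>A \<otimes> \<epsilon>\<close>, which is listed last.\<close>

lemma has_signed_family_double:
  assumes "has_signed_family N 1 (q + 1)"
  shows "has_signed_family (2 * N) (q + 2) (q + 3)"
proof -
  obtain \<pi> s where F: "signed_family {..<N} 1 (q + 1) \<pi> s"
    using assms unfolding has_signed_family_def by blast
  \<comment> \<open>Indices below \<open>q\<close> refer to the old skew operators, which were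
    listed from \<open>1\<close>; index \<open>q + 2\<close> refers to the old symmetric operator,
    listed at \<open>0\<close>. At \<open>q\<close> and \<open>q + 1\<close>, where the two new
    operators stand, the value is a default.\<close>
  define t where "t i = (if i < q then i + 1 else 0)" for i
  define \<pi>' where "\<pi>' i = (\<lambda>(k, b). if i = q then (k, \<not> b) else if i = q + 1 then (k, b) else (\<pi> (t i) k, \<not> b))" for i
  define s' where "s' i = (\<lambda>(k, b). if i = q then 1 else if i = q + 1 then sgn_bit b else s (t i) k * sgn_bit b)" for i
  have t: "t i < q + 1" for i
    by (simp add: t_def)
  note D = signed_familyD[OF F t]
  have "signed_family ({..<N} \<times> UNIV) (q + 2) (q + 3) \<pi>' s'"
    unfolding signed_family_def
  proof (intro conjI allI impI ballI)
    fix i x assume i: "i < q + 3" and x: "x \<in> {..<N} \<times> (UNIV :: bool set)"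
    obtain k b where kb: "x = (k, b)" "k \<in> {..<N}"
      using x by auto
    note Di = D(1-4)[OF kb(2), of i]
    have "t i < 1 \<longleftrightarrow> q \<le> i"
      by (simp add: t_def)
    then show "\<pi>' i x \<in> {..<N} \<times> UNIV" "\<pi>' i (\<pi>' i x) = x" "s' i x * s' i x = 1"
      "s' i (\<pi>' i x) = (if i < q + 2 then s' i x else - s' i x)"
      using Di i kb(2) by (auto simp: \<pi>'_def s'_def kb(1))
    fix j assume j: "j < q + 3" "i \<noteq> j"
    have ne: "t i \<noteq> t j" if "i \<noteq> q" "i \<noteq> q + 1" "j \<noteq> q" "j \<noteq> q + 1"
      using i j that by (auto simp: t_def)
    show "\<pi>' i (\<pi>' j x) = \<pi>' j (\<pi>' i x)"
      using D(5)[OF kb(2) t ne] by (auto simp: \<pi>'_def kb(1))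
    show "s' i x * s' j (\<pi>' i x) = - (s' j x * s' i (\<pi>' j x))"
      using D(6)[OF kb(2) t ne] j(2) by (auto simp: \<pi>'_def s'_def kb(1))
  qed
  then show ?thesis
    by (rule has_signed_familyI) (simp_all add: card_cartesian_product)
qed

text \<open>The map \<open>C\<close> turns inner products of coefficient vectors into half
  anticommutators, so the vertices of a regular simplex in \<open>m\<close> coordinates become the
  required involutions. Being linear combinations of the \<open>E i\<close>, they inherit
  anticommutation with any \<open>T\<close>.\<close>

lemma simplex_involutions_of_clifford:
  fixes E :: "nat \<Rightarrow> 'e::euclidean_space \<Rightarrow> 'e"
  assumes E: "clifford m E" and m: "m \<ge> 1"
  shows "\<exists>R. simplex_involutions (m + 1) R \<and>
    (\<forall>T. linear T \<longrightarrow> (\<forall>i<m. \<forall>x. T (E i x) = - E i (T x)) \<longrightarrow>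
      (\<forall>i x. T (R i x) = - R i (T x)))"
proof -
  define C where "C v x = (\<Sum>j<m. v j *\<^sub>R E j x)" for v :: "nat \<Rightarrow> real" and x
  note D = cliffordD[OF E]
  have linC: "linear (C v)" for v
    unfolding C_def by (intro linear_compose_sum ballI linear_compose_scale_right D(1)) simp
  have symC: "C v x \<bullet> y = x \<bullet> C v y" for v x y
    unfolding C_def inner_sum_left inner_sum_right using D(3) by (intro sum.cong) auto
  have CC: "C v (C w x) = (\<Sum>j<m. \<Sum>k<m. (v j * w k) *\<^sub>R E j (E k x))" for v w x
  proof -
    have "E j (\<Sum>k<m. w k *\<^sub>R E k x) = (\<Sum>k<m. w k *\<^sub>R E j (E k x))" if "j < m" for j
      using D(1)[OF that] by (simp add: linear_sum linear_scale)
    then show ?thesis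
      by (simp add: C_def scaleR_sum_right cong: sum.cong_simp)
  qed
  have ac: "C v (C w x) + C w (C v x) = (2 * (\<Sum>j<m. v j * w j)) *\<^sub>R x" for v w x
  proof -
    have "C w (C v x) = (\<Sum>j<m. \<Sum>k<m. (v j * w k) *\<^sub>R E k (E j x))"
      unfolding CC by (subst sum.swap) (simp add: mult.commute)
    then have "C v (C w x) + C w (C v x) =
        (\<Sum>j<m. \<Sum>k<m. (v j * w k) *\<^sub>R (E j (E k x) + E k (E j x)))"
      by (simp add: CC scaleR_add_right sum.distrib)
    also have "\<dots> = (\<Sum>j<m. \<Sum>k<m. if k = j then (2 * (v j * w j)) *\<^sub>R x else 0)"
    proof (intro sum.cong refl)
      fix j k assume "j \<in> {..<m}" "k \<in> {..<m}"
      then show "(v j * w k) *\<^sub>R (E j (E k x) + E k (E j x)) =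
          (if k = j then (2 * (v j * w j)) *\<^sub>R x else 0)"
        using D(2)[of j x] D(4)[of j k x] by (auto simp flip: scaleR_2)
    qed
    also have "\<dots> = (2 * (\<Sum>j<m. v j * w j)) *\<^sub>R x"
      by (simp add: scaleR_left.sum sum_distrib_left)
    finally show ?thesis .
  qed
  \<comment> \<open>The last vertex has all coordinates \<gamma>, which makes it a unit vector;
    vertex \<open>i\<close> has all coordinates \<beta>, with \<alpha> added at coordinate
    \<open>i - 1\<close>. Two such vertices have squared distance
    \<open>2 * \<alpha>\<^sup>2 = 2 + 2 / m\<close>, and \<beta> makes the vertices sum to
    zero.\<close>
  define \<alpha> \<gamma> \<beta> where "\<alpha> = sqrt (1 + 1 / real m)" and "\<gamma> = sqrt (1 / real m)" and "\<beta> = - (\<gamma> + \<alpha>) / m"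
  have \<alpha>\<gamma>: "\<alpha> * \<alpha> = 1 + 1 / real m" "\<gamma> * \<gamma> = 1 / real m"
    by (simp_all add: \<alpha>_def \<gamma>_def)
  have m\<beta>: "real m * \<beta> = - (\<gamma> + \<alpha>)"
    using m by (simp add: \<beta>_def)
  have cross: "m * (\<beta> * \<beta>) + 2 * (\<alpha> * \<beta>) = - 1 / m"
  proof -
    have "m * (\<beta> * \<beta>) + 2 * (\<alpha> * \<beta>) = \<beta> * (m * \<beta> + 2 * \<alpha>)"
      by (simp add: algebra_simps)
    also have "\<dots> = - (\<alpha> * \<alpha> - \<gamma> * \<gamma>) / m"
      unfolding m\<beta> by (simp add: \<beta>_def algebra_simps flip: diff_divide_distrib add_divide_distrib)
    finally show ?thesis
      by (simp add: \<alpha>\<gamma>)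
  qed
  define v where "v i j = (if i = m + 1 then \<gamma> else if i = j + 1 then \<alpha> + \<beta> else \<beta>)" for i j
  have v: "v i j = \<beta> + (if j = i - 1 then \<alpha> else 0)" if "i \<in> {1..m}" for i j
    using that by (auto simp: v_def)
  have sumv: "(\<Sum>j<m. v i j * w j) = \<beta> * (\<Sum>j<m. w j) + \<alpha> * w (i - 1)" if "i \<in> {1..m}" for i w
  proof -
    have "(\<Sum>j<m. v i j * w j) = (\<Sum>j<m. \<beta> * w j + (if j = i - 1 then \<alpha> * w j else 0))"
      using that by (intro sum.cong) (auto simp: v algebra_simps)
    also have "\<dots> = \<beta> * (\<Sum>j<m. w j) + \<alpha> * w (i - 1)"
      using that by (auto simp: sum.distrib sum_distrib_left)
    finally show ?thesis .
  qed
  have vm: "v (Suc m) = (\<lambda>j. \<gamma>)"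
    by (simp add: v_def fun_eq_iff)
  have tot: "(\<Sum>j<m. v i j) = - \<gamma>" if "i \<in> {1..m}" for i
    using sumv[OF that, of "\<lambda>_. 1"] m\<beta> by (simp add: algebra_simps)
  have dot: "(\<Sum>j<m. v i j * v k j) = (if i = k then 1 else - 1 / m)"
    if "i \<in> {1..m+1}" "k \<in> {1..m+1}" for i k
  proof -
    have "i = m + 1 \<or> i \<in> {1..m}" "k = m + 1 \<or> k \<in> {1..m}"
      using that by auto
    then consider "i = m + 1" "k = m + 1" | "i = m + 1" "k \<in> {1..m}" | "i \<in> {1..m}" "k = m + 1"
      | "i \<in> {1..m}" "k \<in> {1..m}"
      by blast
    then show ?thesis
    proof cases
      case 1
      then show ?thesis using m \<alpha>\<gamma> by (simp add: vm)
    next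
      case 2
      then show ?thesis using \<alpha>\<gamma> tot[of k] by (auto simp: vm simp flip: sum_distrib_left)
    next
      case 3
      then show ?thesis using \<alpha>\<gamma> tot[of i] by (auto simp: vm simp flip: sum_distrib_right)
    next
      case 4
      have "(\<Sum>j<m. v i j * v k j) = \<beta> * (- \<gamma>) + \<alpha> * v k (i - 1)"
        using sumv[OF 4(1)] tot[OF 4(2)] by simp
      also have "- \<gamma> = m * \<beta> + \<alpha>"
        using m\<beta> by simp
      also have "\<beta> * (m * \<beta> + \<alpha>) + \<alpha> * v k (i - 1) =
          (m * (\<beta> * \<beta>) + 2 * (\<alpha> * \<beta>)) + (if i = k then \<alpha> * \<alpha> else 0)"
        using 4 v[OF 4(2), of "i - 1"] by (auto simp: algebra_simps)
      finally show ?thesis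
        unfolding cross by (simp add: \<alpha>\<gamma>)
    qed
  qed
  have sum0: "(\<Sum>i=1..m+1. v i j) = 0" if "j < m" for j
  proof -
    have "(\<Sum>i=1..m+1. v i j) = \<gamma> + (\<Sum>i=1..m. v i j)"
      by (simp add: vm)
    also have "(\<Sum>i=1..m. v i j) = (\<Sum>i=1..m. \<beta> + (if i = j + 1 then \<alpha> else 0))"
      by (intro sum.cong) (auto simp: v)
    also have "\<dots> = m * \<beta> + \<alpha>"
      using that by (simp add: sum.distrib)
    finally show ?thesis
      using m\<beta> by simp
  qed
  have "simplex_involutions (m + 1) (\<lambda>i. C (v i))"
    unfolding simplex_involutions_def
  proof (intro conjI ballI allI impI)
    fix i assume i: "i \<in> {1..m + 1}"
    show "linear (C (v i))" by (rule linC)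
    show "C (v i) x \<bullet> y = x \<bullet> C (v i) y" for x y by (rule symC)
    show "C (v i) (C (v i) x) = x" for x
      using ac[of "v i" "v i" x] dot[OF i i] by (simp flip: scaleR_2)
    fix j x assume j: "j \<in> {1..m + 1}" "i \<noteq> j"
    show "C (v i) (C (v j) x) + C (v j) (C (v i) x) = (- 2 / (real (m + 1) - 1)) *\<^sub>R x"
      using ac[of "v i" "v j" x] dot[OF i j(1)] j(2) by simp
  next
    fix x
    have "(\<Sum>i=1..m+1. C (v i) x) = (\<Sum>j<m. (\<Sum>i=1..m+1. v i j) *\<^sub>R E j x)"
      unfolding C_def scaleR_left.sum by (rule sum.swap)
    also have "\<dots> = 0"
      using sum0 by (intro sum.neutral) auto
    finally show "(\<Sum>i=1..m+1. C (v i) x) = 0" .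
  qed
  moreover have "T (C (v i) x) = - C (v i) (T x)"
    if T: "linear T" "\<forall>i<m. \<forall>x. T (E i x) = - E i (T x)" for T i x
    using T by (simp add: C_def linear_sum linear_scale flip: sum_negf)
  ultimately show ?thesis
    by blast
qed

text \<open>Doubling leaves \<open>q + 2\<close> symmetric operators, which span a simplex with
  \<open>q + 3\<close> vertices, and one skew operator at index \<open>q + 2\<close>. The latter has
  square \<open>-1\<close>, hence is orthogonal, and serves as \<open>T\<close>.\<close>

lemma eitff_of_signed_family:
  assumes F: "has_signed_family r 1 (q + 1)" and dim: "DIM('e::euclidean_space) = 2 * r"
  shows "\<exists>U :: nat \<Rightarrow> 'e set. EITFF (2 * r) r (q + 3) U \<and> totally_symmetric (q + 3) U"
proof -
  obtain \<pi> s where F: "signed_family (Basis :: 'e set) (q + 2) (q + 3) \<pi> s"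
    using signed_family_of_card[OF has_signed_family_double[OF F] finite_Basis dim] by blast
  define O' where "O' i = signed_op (\<pi> i) (s i)" for i
  note P = signed_family_ops[OF F, folded O'_def]
  have lin: "linear (O' i)" for i
    unfolding O'_def by (rule linear_signed_op)
  have "clifford (q + 2) O'"
    unfolding clifford_def
  proof (intro conjI allI impI)
    fix i x assume i: "i < q + 2"
    show "linear (O' i)" by (rule lin)
    show "O' i (O' i x) = x" "O' i x \<bullet> y = x \<bullet> O' i y" for y
      using P(1,2)[of i] i by simp_all
    show "O' i (O' j x) = - O' j (O' i x)" if "j < q + 2" "i \<noteq> j" for j
      using P(3)[of i j] i that by simp
  qed
  then obtain R where R: "simplex_involutions (q + 3) R"
    "\<And>T i x. linear T \<Longrightarrow> (\<forall>i<q + 2. \<forall>x. T (O' i x) = - O' i (T x)) \<Longrightarrow> T (R i x) = - R i (T x)"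
    using simplex_involutions_of_clifford[of "q + 2" O'] by (auto simp: numeral_3_eq_3)
  have anti: "O' (q + 2) (O' i x) = - O' i (O' (q + 2) x)" if "i < q + 2" for i x
    using P(3)[of "q + 2" i] that by simp
  have "O' (q + 2) x \<bullet> O' (q + 2) y = x \<bullet> y" for x y
    using P(1)[of "q + 2" y] P(2)[of "q + 2" x "O' (q + 2) y"] by simp
  then have "orthogonal_transformation (O' (q + 2))"
    using lin by (simp add: orthogonal_transformation_def)
  then show ?thesis
    using eitff_of_simplex_involutions[OF R(1) _ dim] R(2)[OF lin] anti by simp
qed

section \<open>The Radon--Hurwitz number\<close>

definition orthogonal_space :: "(real^'r^'r) set \<Rightarrow> bool" where
  "orthogonal_space S \<longleftrightarrow>
     subspace S \<and> (\<forall>A\<in>S. \<exists>(t::real) Q. orthogonal_matrix Q \<and> A = t *\<^sub>R Q)"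

text \<open>The identity and the skew operators send each \<open>x\<close> to pairwise orthogonal
  vectors of equal length, so a linear combination scales all norms by the length of its coefficient
  vector.\<close>

lemma orthogonal_space_of_signed_family:
  assumes F: "has_signed_family CARD('r::finite) 0 q"
  shows "\<exists>S :: (real^'r^'r) set. orthogonal_space S \<and> dim S = q + 1"
proof -
  have "card (Basis :: (real^'r) set) = CARD('r)"
    by simp
  then obtain \<pi> s where F: "signed_family (Basis :: (real^'r) set) 0 q \<pi> s"
    using signed_family_of_card[OF F finite_Basis] by blast
  define G where "G i = (case i of 0 \<Rightarrow> (\<lambda>x. x) | Suc j \<Rightarrow> signed_op (\<pi> j) (s j))" for i
  have lin: "linear (G i)" for i
    by (cases i) (simp_all add: G_def linear_signed_op linear_ident)
  note P = signed_family_ops[OF F]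
  have GG: "G i x \<bullet> G j x = (if i = j then x \<bullet> x else 0)" if "i \<le> q" "j \<le> q" for i j x
  proof -
    have skew: "signed_op (\<pi> k) (s k) x \<bullet> x = 0" "x \<bullet> signed_op (\<pi> k) (s k) x = 0" if "k < q" for k x
      using P(2)[OF that, of x x] by (simp_all add: inner_commute)
    have two: "signed_op (\<pi> k) (s k) x \<bullet> signed_op (\<pi> l) (s l) x = (if k = l then x \<bullet> x else 0)"
      if "k < q" "l < q" for k l
      using P(1)[OF that(1), of x] P(2)[OF that(1), of x "signed_op (\<pi> l) (s l) x"]
        P(2)[OF that(2), of x "signed_op (\<pi> k) (s k) x"] P(3)[OF that, of x]
      by (auto simp: inner_commute)
    show ?thesis
      using that skew two by (cases i; cases j) (simp_all add: G_def)
  qed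
  define M where "M i = matrix (G i)" for i
  define L where "L t = (\<Sum>i\<le>q. t i *\<^sub>R M i)" for t
  define S where "S = range L"
  have eval: "linear (\<lambda>A. A *v x :: real^'r)" for x :: "real^'r"
    by (rule linearI) (simp_all add: matrix_vector_mult_add_rdistrib scaleR_matrix_vector_assoc)
  have Lmult: "L t *v x = (\<Sum>i\<le>q. t i *\<^sub>R G i x)" for t x
    by (simp add: L_def M_def linear_sum[OF eval] linear_scale[OF eval]
        fun_cong[OF matrix_vector_mul(2)[OF lin]])
  have norm: "(L t *v x) \<bullet> (L t *v x) = (\<Sum>i\<le>q. (t i)\<^sup>2) * (x \<bullet> x)" for t x
  proof -
    have "(L t *v x) \<bullet> (L t *v x) = (\<Sum>i\<le>q. \<Sum>j\<le>q. t i * (t j * (G i x \<bullet> G j x)))"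
      by (simp add: Lmult inner_sum_left inner_sum_right sum_distrib_left inner_commute mult.left_commute)
    also have "\<dots> = (\<Sum>i\<le>q. \<Sum>j\<le>q. if i = j then (t i)\<^sup>2 * (x \<bullet> x) else 0)"
      by (intro sum.cong refl) (simp add: GG power2_eq_square)
    also have "\<dots> = (\<Sum>i\<le>q. (t i)\<^sup>2) * (x \<bullet> x)"
      by (simp add: sum_distrib_right)
    finally show ?thesis .
  qed
  have sub: "subspace S"
    unfolding S_def subspace_def
  proof (intro conjI ballI allI)
    show "0 \<in> range L"
      by (rule range_eqI[of _ _ "\<lambda>_. 0"]) (simp add: L_def)
    fix A assume A: "A \<in> range L"
    then obtain t where t: "A = L t" by blast
    show "c *\<^sub>R A \<in> range L" for c
      by (rule range_eqI[of _ _ "\<lambda>i. c * t i"]) (simp add: L_def t scaleR_sum_right)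
    fix B assume "B \<in> range L"
    then obtain u where u: "B = L u" by blast
    show "A + B \<in> range L"
      by (rule range_eqI[of _ _ "\<lambda>i. t i + u i"]) (simp add: L_def t u scaleR_add_left sum.distrib)
  qed
  have "\<exists>(t::real) Q. orthogonal_matrix Q \<and> A = t *\<^sub>R Q" if AS: "A \<in> S" for A
  proof -
    obtain t where A: "A = L t"
      using AS unfolding S_def by blast
    define c where "c = sqrt (\<Sum>i\<le>q. (t i)\<^sup>2)"
    have c: "c * c = (\<Sum>i\<le>q. (t i)\<^sup>2)"
      by (simp add: c_def sum_nonneg)
    show ?thesis
    proof (cases "c = 0")
      case True
      then have "A *v x = 0" for x
        using norm[of t x] c by (simp add: A)
      then have "A = 0 *\<^sub>R mat 1"
        by (simp add: matrix_eq)
      then show ?thesis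
        using orthogonal_matrix_id by blast
    next
      case False
      define Q where "Q = (1 / c) *\<^sub>R A"
      have "(Q *v x) \<bullet> (Q *v x) = x \<bullet> x" for x
      proof -
        have "(Q *v x) \<bullet> (Q *v x) = (1 / c) * ((1 / c) * ((L t *v x) \<bullet> (L t *v x)))"
          by (simp add: Q_def A scaleR_matrix_vector_assoc[symmetric])
        also have "\<dots> = x \<bullet> x"
          unfolding norm c[symmetric] using False by simp
        finally show ?thesis .
      qed
      then have "orthogonal_transformation ((*v) Q)"
        by (simp add: orthogonal_transformation norm_eq_sqrt_inner matrix_vector_mul_linear)
      then have "orthogonal_matrix Q"
        by (simp add: orthogonal_transformation_matrix)
      moreover have "A = c *\<^sub>R Q"
        using False by (simp add: Q_def)
      ultimately show ?thesis by blast
    qed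
  qed
  then have space: "orthogonal_space S"
    using sub unfolding orthogonal_space_def by blast
  \<comment> \<open>Evaluation at a unit vector sends the \<open>q + 1\<close> generating matrices
    to orthonormal vectors, which bounds \<open>dim S\<close> from below.\<close>
  obtain e :: "real^'r" where e: "e \<bullet> e = 1"
    using nonempty_Basis inner_Basis by fastforce
  have inj: "inj_on (\<lambda>i. G i e) {..q}"
    using GG[of _ _ e] e by (intro inj_onI) (metis atMost_iff zero_neq_one)
  have "pairwise orthogonal ((\<lambda>i. G i e) ` {..q})"
    using GG[of _ _ e] by (auto simp: pairwise_def orthogonal_def)
  moreover have "0 \<notin> (\<lambda>i. G i e) ` {..q}"
  proof
    assume "0 \<in> (\<lambda>i. G i e) ` {..q}"
    then obtain i where "i \<le> q" "G i e = 0" by auto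
    with GG[of i i e] e show False by simp
  qed
  ultimately have "dim ((\<lambda>i. G i e) ` {..q}) = q + 1"
    using pairwise_orthogonal_independent dim_eq_card_independent card_image[OF inj] by fastforce
  moreover have "(\<lambda>i. G i e) ` {..q} \<subseteq> (\<lambda>A. A *v e) ` S"
  proof
    fix y assume "y \<in> (\<lambda>i. G i e) ` {..q}"
    then obtain i where i: "i \<le> q" "y = G i e" by auto
    then have "L (\<lambda>j. if j = i then 1 else 0) *v e = y"
      by (simp add: Lmult if_distrib[of "\<lambda>t. t *\<^sub>R _"] cong: if_cong)
    then show "y \<in> (\<lambda>A. A *v e) ` S"
      unfolding S_def by blast
  qed
  ultimately have "q + 1 \<le> dim S"
    using dim_subset[of "(\<lambda>i. G i e) ` {..q}" "(\<lambda>A. A *v e) ` S"] dim_image_le[OF eval[of e], of S]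
    by linarith
  moreover have "dim S \<le> q + 1"
  proof -
    have "S \<subseteq> span (M ` {..q})"
      unfolding S_def L_def by (auto intro!: span_sum span_scale intro: span_base)
    then have "dim S \<le> card (M ` {..q})"
      by (intro dim_le_card) auto
    also have "\<dots> \<le> q + 1"
      using card_image_le[of "{..q}" M] by simp
    finally show ?thesis .
  qed
  ultimately show ?thesis
    using space by (intro exI[of _ S]) simp
qed

text \<open>The factor is the square of \<open>t\<close>, written through the Frobenius inner
  product as a quadratic form in the matrix itself, so that it can be polarised.\<close>

lemma orthogonal_multiple_mult:
  fixes Q :: "real^'r^'r"
  assumes "orthogonal_matrix Q"
  shows "transpose (t *\<^sub>R Q) *v ((t *\<^sub>R Q) *v x) = ((t *\<^sub>R Q) \<bullet> (t *\<^sub>R Q) / CARD('r)) *\<^sub>R x"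
    and "(t *\<^sub>R Q) *v (transpose (t *\<^sub>R Q) *v x) = ((t *\<^sub>R Q) \<bullet> (t *\<^sub>R Q) / CARD('r)) *\<^sub>R x"
proof -
  have "Q $ i \<bullet> Q $ i = 1" for i
    using assms unfolding orthogonal_matrix_orthonormal_rows row_def
    by (simp add: norm_eq_1)
  then have "Q \<bullet> Q = CARD('r)"
    by (simp add: inner_vec_def)
  then have q: "(t *\<^sub>R Q) \<bullet> (t *\<^sub>R Q) / CARD('r) = t * t"
    by simp
  have tr: "transpose (t *\<^sub>R Q) = t *\<^sub>R transpose Q"
    by (simp add: transpose_def vec_eq_iff)
  have "transpose Q *v (Q *v x) = x" "Q *v (transpose Q *v x) = x"
    using assms by (simp_all add: orthogonal_matrix_def matrix_vector_mul_assoc del: transpose_matrix_vector)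
  then show "transpose (t *\<^sub>R Q) *v ((t *\<^sub>R Q) *v x) = ((t *\<^sub>R Q) \<bullet> (t *\<^sub>R Q) / CARD('r)) *\<^sub>R x"
    "(t *\<^sub>R Q) *v (transpose (t *\<^sub>R Q) *v x) = ((t *\<^sub>R Q) \<bullet> (t *\<^sub>R Q) / CARD('r)) *\<^sub>R x"
    unfolding q tr
    by (simp_all add: scaleR_matrix_vector_assoc[symmetric] matrix_vector_mult_scaleR del: transpose_matrix_vector)
qed

text \<open>Polarising the quadratic identity \<open>sq\<close> shows that the block matrices of
  orthogonal elements of \<open>S\<close> anticommute. An orthonormal basis of \<open>S\<close>,
  rescaled, thus gives \<open>dim S\<close> generators; the diagonal one is put at index
  \<open>dim S\<close>.\<close>

lemma clifford_of_orthogonal_space: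
  fixes S :: "(real^'r^'r) set"
  assumes S: "orthogonal_space S"
  shows "\<exists>E :: nat \<Rightarrow> (real^'r) \<times> (real^'r) \<Rightarrow> (real^'r) \<times> (real^'r). clifford (dim S + 1) E"
proof -
  have sub: "subspace S"
    using S by (simp add: orthogonal_space_def)
  have sq: "transpose A *v (A *v x) = (A \<bullet> A / CARD('r)) *\<^sub>R x"
    "A *v (transpose A *v x) = (A \<bullet> A / CARD('r)) *\<^sub>R x" if A: "A \<in> S" for A x
  proof -
    obtain t Q where "orthogonal_matrix Q" "A = t *\<^sub>R Q"
      using S A unfolding orthogonal_space_def by blast
    then show "transpose A *v (A *v x) = (A \<bullet> A / CARD('r)) *\<^sub>R x"
      "A *v (transpose A *v x) = (A \<bullet> A / CARD('r)) *\<^sub>R x"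
      using orthogonal_multiple_mult by blast+
  qed
  have tadd: "transpose (A + B) = transpose A + transpose B" for A B :: "real^'r^'r"
    by (simp add: transpose_def vec_eq_iff)
  have polar: "transpose A *v (B *v x) + transpose B *v (A *v x) = 0"
    "A *v (transpose B *v x) + B *v (transpose A *v x) = 0"
    if AB: "A \<in> S" "B \<in> S" "A \<bullet> B = 0" for A B x
  proof -
    have "A + B \<in> S"
      using sub AB by (simp add: subspace_add)
    note sqs = sq[OF this, of x]
    have "(A + B) \<bullet> (A + B) = A \<bullet> A + B \<bullet> B"
      using AB(3) by (simp add: inner_add_left inner_add_right inner_commute)
    then have rhs: "((A + B) \<bullet> (A + B) / CARD('r)) *\<^sub>R x =
        (A \<bullet> A / CARD('r)) *\<^sub>R x + (B \<bullet> B / CARD('r)) *\<^sub>R x"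
      by (simp only: add_divide_distrib scaleR_add_left)
    have "transpose (A + B) *v ((A + B) *v x) = transpose A *v (A *v x) + transpose B *v (B *v x) +
        (transpose A *v (B *v x) + transpose B *v (A *v x))"
      "(A + B) *v (transpose (A + B) *v x) = A *v (transpose A *v x) + B *v (transpose B *v x) +
        (A *v (transpose B *v x) + B *v (transpose A *v x))"
      unfolding tadd matrix_vector_mult_add_rdistrib matrix_vector_right_distrib by (simp_all only: ac_simps)
    then show "transpose A *v (B *v x) + transpose B *v (A *v x) = 0"
      "A *v (transpose B *v x) + B *v (transpose A *v x) = 0"
      unfolding sqs rhs sq[OF AB(1)] sq[OF AB(2)] by (simp_all only: add_cancel_right_right)
  qed
  obtain B where B: "B \<subseteq> S" "pairwise orthogonal B" "\<And>x. x \<in> B \<Longrightarrow> norm x = 1"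
    "independent B" "card B = dim S"
    using orthonormal_basis_subspace[OF sub] by blast
  have "finite B"
    using B(4) independent_imp_finite by blast
  then obtain b where b: "bij_betw b {..<dim S} B"
    using B(5) ex_bij_betw_nat_finite by (metis atLeast0LessThan)
  \<comment> \<open>The factor raises the squared Frobenius norm to \<open>CARD('r)\<close>, that of
    an orthogonal matrix.\<close>
  define G where "G i = sqrt CARD('r) *\<^sub>R b i" for i
  have bB: "b i \<in> B" if "i < dim S" for i
    using b that by (auto simp: bij_betw_def)
  have GS: "G i \<in> S" if "i < dim S" for i
    using bB[OF that] B(1) sub by (auto simp: G_def subspace_scale)
  have "G i \<bullet> G i = CARD('r)" if "i < dim S" for i
    using B(3)[OF bB[OF that]] by (simp add: G_def norm_eq_1)
  then have Gsq: "transpose (G i) *v (G i *v x) = x" "G i *v (transpose (G i) *v x) = x"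
    if "i < dim S" for i x
    using sq[OF GS[OF that], of x] that by simp_all
  have Gorth: "G i \<bullet> G j = 0" if "i < dim S" "j < dim S" "i \<noteq> j" for i j
  proof -
    have "b i \<noteq> b j"
      using b that by (auto simp: bij_betw_def inj_on_def)
    then show ?thesis
      using B(2) bB that by (auto simp: G_def pairwise_def orthogonal_def)
  qed
  define E where "E i = (\<lambda>(x, y). if i = dim S then (x, - y) else (transpose (G i) *v y, G i *v x))" for i
  have adj: "(transpose A *v y) \<bullet> x = y \<bullet> (A *v x)" "x \<bullet> (transpose A *v y) = (A *v x) \<bullet> y"
    for A :: "real^'r^'r" and x y
    using dot_lmul_matrix[of y A x] by (simp_all add: inner_commute[of x] inner_commute[of _ y])
  have "clifford (dim S + 1) E"
    unfolding clifford_def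
  proof (intro conjI allI impI)
    fix i assume i: "i < dim S + 1"
    show "linear (E i)"
      by (rule linearI)
        (auto simp: E_def matrix_vector_right_distrib matrix_vector_mult_scaleR split: prod.split
          simp del: transpose_matrix_vector)
    show "E i (E i z) = z" for z
      using Gsq[of i] i by (cases z) (auto simp: E_def simp del: transpose_matrix_vector)
    show "E i z \<bullet> w = z \<bullet> E i w" for z w
      by (cases z; cases w)
        (auto simp: E_def inner_Pair adj simp del: transpose_matrix_vector)
    fix j and z :: "(real^'r) \<times> (real^'r)" assume j: "j < dim S + 1" "i \<noteq> j"
    obtain x y where z: "z = (x, y)" by fastforce
    consider "i = dim S" "j < dim S" | "j = dim S" "i < dim S" | "i < dim S" "j < dim S"
      using i j by linarith
    then show "E i (E j z) = - E j (E i z)"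
    proof cases
      case 3
      then show ?thesis
        using polar[OF GS GS Gorth, OF 3 3 j(2)] by (simp add: E_def z eq_neg_iff_add_eq_0 del: transpose_matrix_vector)
    qed (use j in \<open>simp_all add: E_def z linear_neg[OF matrix_vector_mul_linear] del: transpose_matrix_vector\<close>)
  qed
  then show ?thesis by blast
qed

lemma clifford_mono:
  assumes "clifford m E" "k \<le> m"
  shows "clifford k E"
  unfolding clifford_def
  by (intro conjI allI impI; rule cliffordD[OF assms(1)]; use assms(2) in simp)

text \<open>The signed family and the identity attain \<open>q + 1\<close>. A space of dimension at
  least \<open>q + 2\<close> would supply at least \<open>q + 3\<close> generators, counting the
  diagonal one.\<close>

lemma radon_hurwitz_eqI:
  assumes F: "has_signed_family CARD('r::finite) 0 q"
    and no: "\<And>E :: nat \<Rightarrow> (real^'r) \<times> (real^'r) \<Rightarrow> _. \<not> clifford (q + 3) E"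
  shows "radon_hurwitz TYPE('r) = q + 1"
proof -
  let ?D = "{dim S |S :: (real^'r^'r) set. orthogonal_space S}"
  have "Max ?D = q + 1"
  proof (rule Max_eqI)
    show le: "d \<le> q + 1" if D: "d \<in> ?D" for d
    proof (rule ccontr)
      assume d: "\<not> d \<le> q + 1"
      obtain S :: "(real^'r^'r) set" where "orthogonal_space S" "d = dim S"
        using D by blast
      then obtain E :: "nat \<Rightarrow> (real^'r) \<times> (real^'r) \<Rightarrow> (real^'r) \<times> (real^'r)" where "clifford (d + 1) E"
        using clifford_of_orthogonal_space by blast
      then have "clifford (q + 3) E"
        using d by (elim clifford_mono) simp
      with no show False by blast
    qed
    show "finite ?D"
      using le by (intro finite_subset[of ?D "{..q + 1}"]) auto
    show "q + 1 \<in> ?D"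
      using orthogonal_space_of_signed_family[OF F] by force
  qed
  then show ?thesis
    unfolding radon_hurwitz_def orthogonal_space_def .
qed

lemma has_signed_family_skew:
  assumes "has_signed_family N p (p + q)"
  shows "has_signed_family N 0 q"
proof -
  obtain \<pi> s where F: "signed_family {..<N} p (p + q) \<pi> s"
    using assms unfolding has_signed_family_def by blast
  have "signed_family {..<N} 0 q (\<lambda>i. \<pi> (p + i)) (\<lambda>i. s (p + i))"
    unfolding signed_family_def
  proof (intro conjI allI impI ballI)
    fix i k assume i: "i < q" and k: "k \<in> {..<N}"
    have "p + i < p + q" using i by simp
    note D = signed_familyD[OF F this k]
    show "\<pi> (p + i) k \<in> {..<N}" "\<pi> (p + i) (\<pi> (p + i) k) = k" "s (p + i) k * s (p + i) k = 1"
      "s (p + i) (\<pi> (p + i) k) = (if i < 0 then s (p + i) k else - s (p + i) k)"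
      using D(1-4) by simp_all
    fix j assume j: "j < q" "i \<noteq> j"
    show "\<pi> (p + i) (\<pi> (p + j) k) = \<pi> (p + j) (\<pi> (p + i) k)"
      by (rule D(5)) (use j in simp_all)
    show "s (p + i) k * s (p + j) (\<pi> (p + i) k) = - (s (p + j) k * s (p + i) (\<pi> (p + j) k))"
      by (rule D(6)) (use j in simp_all)
  qed
  then show ?thesis
    unfolding has_signed_family_def by blast
qed

lemma not_dvd_odd_power:
  assumes "2 ^ (k + 1) * 16 ^ b dvd 2 ^ k * 16 ^ b * (2 * a + 1 :: nat)"
  shows False
proof -
  have "2 ^ k * 16 ^ b * 2 dvd 2 ^ k * 16 ^ b * (2 * a + 1 :: nat)"
    using assms by (simp add: ac_simps)
  then have "2 dvd 2 * a + 1"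
    by (subst (asm) nat_mult_dvd_cancel1) auto
  then show False by presburger
qed

section \<open>Totally symmetric EITFFs\<close>

theorem theorem4p4:
  fixes a b c r n :: nat
  assumes "c \<le> 3"
    and "r = (2 * a + 1) * 2 ^ (4 * b + c)"
    and "CARD('r::finite) = r"
    and "DIM('e::euclidean_space) = 2 * r"
    and "n = radon_hurwitz TYPE('r) + 2"
  shows "radon_hurwitz TYPE('r) = 8 * b + 2 ^ c \<and>
    (c \<in> {0, 1} \<longrightarrow>
       (\<exists>U :: nat \<Rightarrow> 'e set. EITFF (2 * r) r n U \<and> totally_symmetric n U)) \<and>
    (c = 3 \<longrightarrow>
       \<not> (\<exists>U :: nat \<Rightarrow> 'e set. EITFF (2 * r) r n U \<and> totally_symmetric n U))"
proof -
  have pow: "(2::nat) ^ (4 * b) = 16 ^ b"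
    by (simp add: power_mult)
  have r: "r = 2 ^ c * 16 ^ b * (2 * a + 1)" "2 * r = 2 ^ (c + 1) * 16 ^ b * (2 * a + 1)"
    using assms(2) unfolding power_add pow by simp_all
  have family: "has_signed_family r p (q + 8 * b)" if "has_signed_family (2 ^ c) p q" "p \<le> q" for p q
    using has_signed_family_mult[OF has_signed_family_period[OF that], of b "2 * a + 1"]
    by (simp add: r(1) ac_simps)
  have c: "c = 0 \<or> c = 1 \<or> c = 2 \<or> c = 3"
    using assms(1) by auto
  \<comment> \<open>The number of skew operators, one less than the Radon-Hurwitz number because the
    identity is not counted; hence \<open>n = ?q + 3\<close>.\<close>
  let ?q = "8 * b + (2 ^ c - 1)"
  have q: "?q + 1 = 8 * b + 2 ^ c"
    by simp
  \<comment> \<open>For these \<open>c\<close> a symmetric operator accompanies the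
    \<open>?q\<close> skew ones, as \<open>eitff_of_signed_family\<close> requires.\<close>
  have sym: "has_signed_family r 1 (?q + 1)" if "c \<in> {0, 1}"
  proof -
    have "has_signed_family (2 ^ c) 1 (2 ^ c)"
      using that has_signed_family_base(1,2) by (auto simp only: power_0 power_one_right)
    from family[OF this] show ?thesis
      by (simp add: add.commute)
  qed
  have skew: "has_signed_family r 0 ?q"
  proof (cases "c \<in> {0, 1}")
    case True
    then show ?thesis
      using has_signed_family_skew[of r 1 ?q] sym by simp
  next
    case False
    then have "has_signed_family (2 ^ c) 0 (2 ^ c - 1)"
      using c has_signed_family_base(3,4) by auto
    from family[OF this] show ?thesis
      by (simp add: add.commute)
  qed
  have dimp: "DIM((real^'r) \<times> (real^'r)) = 2 ^ (c + 1) * 16 ^ b * (2 * a + 1)"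
    using assms(3) r(2) by simp
  \<comment> \<open>For \<open>c = 0, 1, 2\<close> the count \<open>?q + 3\<close> exceeds
    \<open>8 * b\<close> by \<open>3\<close>, \<open>4\<close>, \<open>6\<close>; for
    \<open>c = 3\<close> it completes another block of eight and leaves \<open>2\<close>. Each time
    the dimension would need one more factor of two than \<open>2 * r\<close> has.\<close>
  have no: "\<not> clifford (?q + 3) E" for E :: "nat \<Rightarrow> (real^'r) \<times> (real^'r) \<Rightarrow> (real^'r) \<times> (real^'r)"
  proof
    assume E: "clifford (?q + 3) E"
    have "2 ^ (c + 1 + 1) * 16 ^ b dvd DIM((real^'r) \<times> (real^'r))"
      using c
    proof (elim disjE)
      assume "c = 0"
      then have "?q + 3 = 8 * b + 3" "(2::nat) ^ (c + 1 + 1) * 16 ^ b = 4 * 16 ^ b"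
        by simp_all
      then show ?thesis
        using E clifford_dvd(2)[of b E] by (simp only:)
    next
      assume "c = 1"
      then have "?q + 3 = 8 * b + 4" "(2::nat) ^ (c + 1 + 1) * 16 ^ b = 8 * 16 ^ b"
        by simp_all
      then show ?thesis
        using E clifford_dvd(3)[of b E] by (simp only:)
    next
      assume "c = 2"
      then have "?q + 3 = 8 * b + 6" "(2::nat) ^ (c + 1 + 1) * 16 ^ b = 16 * 16 ^ b"
        by simp_all
      then show ?thesis
        using E clifford_dvd(4)[of b E] by (simp only:)
    next
      assume "c = 3"
      then have "?q + 3 = 8 * (b + 1) + 2" "(2::nat) ^ (c + 1 + 1) * 16 ^ b = 2 * 16 ^ (b + 1)"
        by simp_all
      then show ?thesis
        using E clifford_dvd(1)[of "b + 1" E] by (simp only:)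
    qed
    then show False
      unfolding dimp by (rule not_dvd_odd_power)
  qed
  have rh: "radon_hurwitz TYPE('r) = 8 * b + 2 ^ c"
    using radon_hurwitz_eqI[where 'r = 'r and q = ?q] skew no assms(3) q by simp
  then have n: "n = ?q + 3"
    using assms(5) q by simp
  have "\<exists>U :: nat \<Rightarrow> 'e set. EITFF (2 * r) r n U \<and> totally_symmetric n U" if "c \<in> {0, 1}"
    unfolding n using sym[OF that] assms(4) by (rule eitff_of_signed_family)
  moreover have False
    if c3: "c = 3" and U: "EITFF (2 * r) r n U" "totally_symmetric n U" for U :: "nat \<Rightarrow> 'e set"
  proof -
    \<comment> \<open>Here \<open>n\<close> has the form required by
      \<open>totally_symmetric_eitff_dvd\<close>, which asks for \<open>2 ^ 4 * 16 ^ b\<close> to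
      divide \<open>r\<close>, while \<open>r\<close> is an odd multiple of
      \<open>2 ^ 3 * 16 ^ b\<close>.\<close>
    have "n = 8 * (b + 1) + 2"
      using n c3 by simp
    then have "16 ^ (b + 1) dvd r"
      using totally_symmetric_eitff_dvd[of r "b + 1" U] U r(1) by simp
    then have "2 ^ (3 + 1) * 16 ^ b dvd 2 ^ 3 * 16 ^ b * (2 * a + 1)"
      using r(1) c3 by simp
    then show False
      by (rule not_dvd_odd_power)
  qed
  ultimately show ?thesis
    using rh by blast
qed

end
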